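(* Let $W:[0,1]\to\mathbb C$ be $(\sigma_*,2)$-Gevrey regular and $0<\sigma<\sigma_*$. Suppose $\psi$ is a smooth solution on $t\ge0$, $x\in(0,1]$ of $\frac{\partial}{\partial x}\big(x^2\frac{\partial\psi}{\partial x}\big)+\frac{\partial^2\psi}{\partial x\partial t}-W(x)\psi=0$ with Dirichlet condition $\psi(t,1)=0$. If $\psi(0,\cdot)\in X^\sigma$, then $\psi(t,\cdot)\in X^\sigma$ for all $t\ge0$, and there is a constant $c\ge0$ (independent of $\psi$) such that for all $0\le t_1\le t_2$: $\|\psi(t_2)\|_{X^\sigma}-\|\psi(t_1)\|_{X^\sigma}\le c\int_{t_1}^{t_2}\|\psi(t)\|_{X^\sigma}dt$.
   Context: Let $I=(0,1)$. A function $u\in C^\infty(\overline I)$ is $(\sigma,k)$-Gevrey regular ($\sigma,k>0$) if there is $C>0$ with $\sup_{x\in I}|u^{(n)}(x)|\le C\sigma^{-n}(n!)^k$ for all $n\ge0$. For $\sigma>0$, $u\in C^\infty(\overline I)$, integers $0\le N\le M$, $k\in\{0,1,2\}$, $l\in\{0,1\}$, set $|u|^{N,M}_{\sigma,k,l}=\big(\sum_{n=N}^M\frac{\sigma^{2n}}{n!^2(n+1)!^2}n^{k+l}\int_0^1(x/\sigma)^k|\partial_x^nu|^2dx\big)^{1/2}$ (with $0^0:=1$), $|u|^N_{\sigma,k,l}$ the same with $M=\infty$; $\|u\|_{\sigma,0,0}=|u|^0_{\sigma,0,0}$. Boundary seminorms: $[u]^{N,M}_\sigma=(\sum_{n=N}^M\frac{\sigma^{2n+1}}{n!^2(n+1)!^2}|u^{(n)}(0)|^2)^{1/2}$,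 $[u]^N_\sigma$ the same with $M=\infty$. $X^\sigma=\{u\in C^\infty(\overline I):u(1)=0,\ \|\partial_xu\|_{\sigma,0,0}+|\partial_xu|^0_{\sigma,1,0}+|\partial_xu|^0_{\sigma,2,0}+[\partial_xu]^0_\sigma<\infty\}$, a Hilbert space with norm $\|u\|_{X^\sigma}=(\|\partial_xu\|_{\sigma,0,0}^2+(|\partial_xu|^0_{\sigma,1,0})^2+(|\partial_xu|^0_{\sigma,2,0})^2+([\partial_xu]^0_\sigma)^2)^{1/2}$. *)

theory Defs
  imports "HOL-Analysis.Analysis"
begin

fun dn :: "(real \<Rightarrow> complex) \<Rightarrow> nat \<Rightarrow> real \<Rightarrow> complex" where
  "dn u 0 = u"
| "dn u (Suc n) = (\<lambda>x. vector_derivative (dn u n) (at x within {0..1}))"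

definition smooth01 :: "(real \<Rightarrow> complex) \<Rightarrow> bool" where
  "smooth01 u \<longleftrightarrow>
     (\<forall>n. \<forall>x\<in>{0..1}. (dn u n has_vector_derivative dn u (Suc n) x) (at x within {0..1}))"

definition gevrey_regular :: "real \<Rightarrow> real \<Rightarrow> (real \<Rightarrow> complex) \<Rightarrow> bool" where
  "gevrey_regular \<sigma> k u \<longleftrightarrow> smooth01 u \<and>
     (\<exists>C>0. \<forall>n. \<forall>x\<in>{0<..<1::real}. cmod (dn u n x) \<le> C / \<sigma> ^ n * (fact n) powr k)"

definition semi_term :: "real \<Rightarrow> nat \<Rightarrow> nat \<Rightarrow> (real \<Rightarrow> complex) \<Rightarrow> nat \<Rightarrow> real" where
  "semi_term \<sigma> k l v n =
     \<sigma> ^ (2 * n) / ((fact n) ^ 2 * (fact (n + 1)) ^ 2) * real n ^ (k + l)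
       * integral {0..1} (\<lambda>x. (x / \<sigma>) ^ k * (cmod (dn v n x))\<^sup>2)"

definition bdry_term :: "real \<Rightarrow> (real \<Rightarrow> complex) \<Rightarrow> nat \<Rightarrow> real" where
  "bdry_term \<sigma> v n = \<sigma> ^ (2 * n + 1) / ((fact n) ^ 2 * (fact (n + 1)) ^ 2) * (cmod (dn v n 0))\<^sup>2"

definition Xsig :: "real \<Rightarrow> (real \<Rightarrow> complex) set" where
  "Xsig \<sigma> = {u. smooth01 u \<and> u 1 = 0 \<and>
      summable (semi_term \<sigma> 0 0 (dn u 1)) \<and>
      summable (semi_term \<sigma> 1 0 (dn u 1)) \<and>
      summable (semi_term \<sigma> 2 0 (dn u 1)) \<and>
      summable (bdry_term \<sigma> (dn u 1))}"

definition Xnorm :: "real \<Rightarrow> (real \<Rightarrow> complex) \<Rightarrow> real" where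
  "Xnorm \<sigma> u = sqrt ((\<Sum>n. semi_term \<sigma> 0 0 (dn u 1) n) + (\<Sum>n. semi_term \<sigma> 1 0 (dn u 1) n)
                     + (\<Sum>n. semi_term \<sigma> 2 0 (dn u 1) n) + (\<Sum>n. bdry_term \<sigma> (dn u 1) n))"

text \<open>A function given on (0,1] belongs to X^sigma if it agrees on (0,1] with an element of X^sigma
  (its unique smooth extension to [0,1]); its norm is the norm of that extension.\<close>
definition inX :: "real \<Rightarrow> (real \<Rightarrow> complex) \<Rightarrow> bool" where
  "inX \<sigma> f \<longleftrightarrow> (\<exists>u\<in>Xsig \<sigma>. \<forall>x\<in>{0<..1}. u x = f x)"

definition normX :: "real \<Rightarrow> (real \<Rightarrow> complex) \<Rightarrow> real" where
  "normX \<sigma> f = Xnorm \<sigma> (SOME u. u \<in> Xsig \<sigma> \<and> (\<forall>x\<in>{0<..1}. u x = f x))"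

definition strip :: "(real \<times> real) set" where
  "strip = {0..} \<times> {0<..1}"

text \<open>psi t x is a smooth function on the strip (D i j = d_t^i d_x^j psi, jointly differentiable
  within the strip) solving d_x(x^2 d_x psi) + d_x d_t psi - W psi = 0 there.\<close>
definition strip_solution :: "(real \<Rightarrow> complex) \<Rightarrow> (real \<Rightarrow> real \<Rightarrow> complex) \<Rightarrow> bool" where
  "strip_solution W \<psi> \<longleftrightarrow>
    (\<exists>D :: nat \<Rightarrow> nat \<Rightarrow> real \<Rightarrow> real \<Rightarrow> complex.
       (\<forall>p\<in>strip. D 0 0 (fst p) (snd p) = \<psi> (fst p) (snd p)) \<and>
       (\<forall>i j. \<forall>p\<in>strip.
          ((\<lambda>q. D i j (fst q) (snd q)) has_derivative
            (\<lambda>h. fst h *\<^sub>R D (Suc i) j (fst p) (snd p) + snd h *\<^sub>R D i (Suc j) (fst p) (snd p)))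
          (at p within strip)) \<and>
       (\<forall>p\<in>strip.
          complex_of_real ((snd p)\<^sup>2) * D 0 2 (fst p) (snd p)
          + complex_of_real (2 * snd p) * D 0 1 (fst p) (snd p)
          + D 1 1 (fst p) (snd p) - W (snd p) * D 0 0 (fst p) (snd p) = 0))"

end

theory Submission
  imports Defs
begin

text \<open>
  Put $v = \partial_x\psi$. Then $v_n = \partial_x^n v$ satisfies the transport equation
  $\partial_t v_n + x^2 \partial_x v_n + 2(n+1) x v_n + n(n+1) v_{n-1} = \partial_x^n (W\psi)$, whose
  characteristics $x' = x^2$ never reach $x = 0$ backwards in time. Truncate the square of the
  $X^\sigma$ norm to orders $n \le N$ and to $x \ge a(t)$ for a characteristic $a$, evaluating the
  boundary seminorm at $a(t)$. There is no flux through the curve, the term $n(n+1) v_{n-1}$ is an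
  exact derivative when paired with $v_n$, and $n(n+1)$ is just what the Gevrey weights gain in passing
  from $n-1$ to $n$. Hence the truncated energy $E$ satisfies $E' \le c E$ with $c$ independent of $N$ and
  of the curve; the potential term is a discrete convolution with the summable sequence $(\sigma/\sigma_*)^m$.

  Moving the curve to $x = 0$, the boundary part of $E$ bounds every $v_n(t,\cdot)$ near $0$, so that
  $\psi(t,\cdot)$ extends smoothly; letting then $N \to \infty$ shows that
  $e^{-ct/2} \|\psi(t)\|_{X^\sigma}$ is nonincreasing, which is stronger than the integral inequality.
\<close>

section \<open>Calculus and sums\<close>

text \<open>For t > 0 nothing is known a priori as x tends to 0: \<open>strip_solution\<close> gives
  smoothness on (0,1] only, so no integral may be differentiated or integrated by parts down to 0.
  Hence the region x >= a(t) with a' = a^2. Solving backwards from a(t2) = eps gives a(t) = eps / (1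
  + eps (t2 - t)), which lies in (0,eps] and tends to 0 with eps. Cutting at order N leaves a closed
  system: the equation for v_n sees higher orders only through x^2 d_x v_n, which is integrated by
  parts in the interior and absorbed by the motion along the characteristic on the curve, while the
  forcing and n(n+1) v_{n-1} look at lower orders. The exact derivative leaves n(n+1) |v_{n-1}|^2 at
  the curve, and the boundary seminorm pays for it. The factors n^k with k <= 2 are affordable
  because n^k <= n(n+1) for n >= 1 and n^k <= (n+1)^2: the first is paid by the ratio of consecutive
  weights, the second by a spare factor n+1 in the Gevrey estimate of the potential term. psi itself
  is not in the energy; the Dirichlet condition recovers it from v_0.\<close>

lemma has_real_derivative_integral_moving_lower:
  fixes F F' :: "real \<Rightarrow> real \<Rightarrow> real" and a :: "real \<Rightarrow> real"
  assumes F: "\<And>t x. t \<in> {p..q} \<Longrightarrow> x \<in> {d..e} \<Longrightarrow>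
      ((\<lambda>t. F t x) has_real_derivative F' t x) (at t within {p..q})"
    and F_cont: "continuous_on ({p..q} \<times> {d..e}) (\<lambda>(t, x). F t x)"
    and F'_cont: "continuous_on ({p..q} \<times> {d..e}) (\<lambda>(t, x). F' t x)"
    and a: "\<And>t. t \<in> {p..q} \<Longrightarrow> a t \<in> {d..e}"
    and a': "(a has_real_derivative a') (at t within {p..q})"
    and t: "t \<in> {p..q}"
  shows "((\<lambda>t. integral {a t..e} (F t)) has_real_derivative
           integral {a t..e} (F' t) - a' * F t (a t)) (at t within {p..q})"
proof -
  have slice: "continuous_on {y..e} (F s)" "continuous_on {y..e} (F' s)"
    if "s \<in> {p..q}" "y \<in> {d..e}" for s y
  proof -
    have "continuous_on {y..e} (Pair s)" "Pair s ` {y..e} \<subseteq> {p..q} \<times> {d..e}"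
      using that by (auto intro!: continuous_intros)
    from continuous_on_compose2[OF F_cont this] continuous_on_compose2[OF F'_cont this]
    show "continuous_on {y..e} (F s)" "continuous_on {y..e} (F' s)" by simp_all
  qed
  have at_in: "a t \<in> {d..e}" using a t by blast
  \<comment> \<open>Time and lower limit are first varied separately, by the Leibniz rule and by the
    fundamental theorem. Joint differentiability then needs joint continuity of only one partial
    derivative, here -F; composing with s -> (s, a s) gives the claim.\<close>
  have 1: "((\<lambda>s. integral {a t..e} (F s)) has_derivative (\<lambda>h. h * integral {a t..e} (F' t)))
      (at t within {p..q})"
  proof -
    have "((\<lambda>s. integral (cbox (a t) e) (F s)) has_field_derivative integral (cbox (a t) e) (F' t))
      (at t within {p..q})"
      using F slice at_in t
      by (intro leibniz_rule_field_derivative)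
        (auto intro!: integrable_continuous_real continuous_on_subset[OF F'_cont])
    then show ?thesis by (simp add: has_field_derivative_def mult_commute_abs)
  qed
  have 2: "((\<lambda>y. integral {y..e} (F s)) has_derivative blinfun_apply (blinfun_scaleR_left (- F s y)))
      (at y within {d..e})" if "s \<in> {p..q}" "y \<in> {d..e}" for s y
  proof -
    have de: "d \<in> {d..e}" using that by auto
    have int: "F s integrable_on {d..e}"
      using slice[OF that(1) de] by (auto intro: integrable_continuous_real)
    have int': "((\<lambda>y. integral {d..e} (F s) - integral {d..y} (F s)) has_vector_derivative 0 - F s y)
      (at y within {d..e})"
      by (intro derivative_intros integral_has_vector_derivative slice that de)
    have split: "integral {x..e} (F s) = integral {d..e} (F s) - integral {d..x} (F s)"
      if "x \<in> {d..e}" for x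
      using Henstock_Kurzweil_Integration.integral_combine[OF _ _ int, of x] that by simp
    have "((\<lambda>y. integral {y..e} (F s)) has_vector_derivative - F s y) (at y within {d..e})"
      using has_vector_derivative_transform[OF that(2) split int'] by simp
    then show ?thesis by (simp add: has_vector_derivative_def)
  qed
  have 3: "continuous (at (t, a t) within {p..q} \<times> {d..e}) (\<lambda>(s, y). blinfun_scaleR_left (- F s y))"
  proof -
    have "continuous_on ({p..q} \<times> {d..e}) (\<lambda>(s, y). blinfun_scaleR_left (- F s y))"
      using F_cont by (auto simp: split_beta intro!: continuous_intros)
    then show ?thesis using t at_in by (simp add: continuous_on_eq_continuous_within)
  qed
  have 4: "((\<lambda>(s, y). integral {y..e} (F s)) has_derivative
      (\<lambda>(h, k). h * integral {a t..e} (F' t) + blinfun_scaleR_left (- F t (a t)) k))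
      (at (t, a t) within {p..q} \<times> {d..e})"
    by (rule has_derivative_partialsI[OF 1 2 3]) (use at_in in auto)
  have 5: "((\<lambda>s. (s, a s)) has_derivative (\<lambda>h. (h, a' * h))) (at t within {p..q})"
    using a' by (intro has_derivative_Pair has_derivative_ident) (simp add: has_field_derivative_def)
  have "((\<lambda>s. (\<lambda>(s, y). integral {y..e} (F s)) (s, a s)) has_derivative
      (\<lambda>h. (\<lambda>(h, k). h * integral {a t..e} (F' t) + blinfun_scaleR_left (- F t (a t)) k) (h, a' * h)))
      (at t within {p..q})"
    by (rule has_derivative_in_compose[OF 5 has_derivative_subset[OF 4]]) (use a in auto)
  then show ?thesis
    unfolding has_field_derivative_def case_prod_conv
    by (rule has_derivative_eq_rhs) (auto simp: algebra_simps)
qed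

section \<open>Iterated derivatives on [0,1] and extension to x = 0\<close>

lemma dn_Suc_shift: "dn (dn u 1) n = dn u (Suc n)"
  by (induction n) auto

text \<open>\<open>dn\<close> takes its derivatives by choice; uniqueness of derivatives within the
  nondegenerate interval [0,1] identifies them with any explicit chain \<open>G\<close>.\<close>

lemma dn_eqI:
  assumes "\<And>n x. x \<in> {0..1} \<Longrightarrow> (G n has_vector_derivative G (Suc n) x) (at x within {0..1})"
    and "\<And>x. x \<in> {0..1} \<Longrightarrow> u x = G 0 x"
    and "x \<in> {0..1}"
  shows "dn u n x = G n x"
  using assms(3)
proof (induction n arbitrary: x)
  case 0
  then show ?case using assms(2) by simp
next
  case (Suc n)
  have "(dn u n has_vector_derivative G (Suc n) x) (at x within {0..1})"
    by (rule has_vector_derivative_transform[OF Suc.prems _ assms(1)]) (use Suc in auto)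
  then show ?case
    using vector_derivative_within_cbox[of 0 1 x] Suc.prems by simp
qed

lemma smooth01I:
  assumes "\<And>n x. x \<in> {0..1} \<Longrightarrow> (G n has_vector_derivative G (Suc n) x) (at x within {0..1})"
    and "\<And>x. x \<in> {0..1} \<Longrightarrow> u x = G 0 x"
  shows "smooth01 u"
  unfolding smooth01_def
proof (intro allI ballI)
  fix n and x :: real assume x: "x \<in> {0..1}"
  have "(dn u n has_vector_derivative G (Suc n) x) (at x within {0..1})"
    by (rule has_vector_derivative_transform[OF x _ assms(1)]) (use x dn_eqI[OF assms] in auto)
  then show "(dn u n has_vector_derivative dn u (Suc n) x) (at x within {0..1})"
    using dn_eqI[OF assms x] by metis
qed

lemma smooth01_continuous_on:
  assumes "smooth01 u"
  shows "continuous_on {0..1} (dn u n)"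
  using assms has_vector_derivative_continuous
  unfolding smooth01_def continuous_on_eq_continuous_within by blast

text \<open>Boundedness of \<open>g (Suc n)\<close> makes \<open>g n\<close> Lipschitz, hence
  uniformly continuous, so it extends continuously to 0. The extensions remain a chain of
  derivatives at 0 itself because each is a constant plus the integral of the next.\<close>

lemma smooth_extension_at_0:
  fixes g :: "nat \<Rightarrow> real \<Rightarrow> complex"
  assumes deriv: "\<And>n x. x \<in> {0<..1} \<Longrightarrow> (g n has_vector_derivative g (Suc n) x) (at x within {0<..1})"
    and bdd: "\<And>n. \<exists>B. \<forall>x\<in>{0<..1}. cmod (g n x) \<le> B"
  obtains u where "smooth01 u" "\<And>n x. x \<in> {0<..1} \<Longrightarrow> dn u n x = g n x"
proof -
  have "\<exists>h. continuous_on {0..1} h \<and> (\<forall>x\<in>{0<..1}. h x = g n x)" for n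
  proof -
    obtain B where B: "\<And>x. x \<in> {0<..1} \<Longrightarrow> cmod (g (Suc n) x) \<le> B" using bdd by blast
    have "norm (g n x - g n y) \<le> B * norm (x - y)" if "x \<in> {0<..1}" "y \<in> {0<..1}" for x y
    proof (rule differentiable_bound[OF _ _ _ that(1) that(2)])
      show "(g n has_derivative (\<lambda>h. h *\<^sub>R g (Suc n) x)) (at x within {0<..1})"
        if "x \<in> {0<..1}" for x
        using deriv[OF that] by (simp add: has_vector_derivative_def)
      show "onorm (\<lambda>h. h *\<^sub>R g (Suc n) x) \<le> B" if "x \<in> {0<..1}" for x
        using B[OF that] by (intro onorm_le) (simp add: mult.commute[of B] mult_left_mono)
    qed simp
    moreover have "0 \<le> B" using order_trans[OF norm_ge_zero B[of 1]] by simp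
    ultimately have "B-lipschitz_on {0<..1} (g n)"
      by (intro lipschitz_onI) (auto simp: dist_norm)
    then have "uniformly_continuous_on {0<..1} (g n)"
      by (rule lipschitz_on_uniformly_continuous)
    from uniformly_continuous_on_extension_on_closure[OF this] obtain h where
      "uniformly_continuous_on (closure {0<..1}) h" "\<And>x. x \<in> {0<..1} \<Longrightarrow> g n x = h x" by metis
    then show ?thesis
      using uniformly_continuous_imp_continuous[of "{0..1}" h] closure_greaterThanAtMost[of 0 "1::real"]
      by auto
  qed
  then obtain h where cont: "\<And>n. continuous_on {0..1} (h n)"
    and eq: "\<And>n x. x \<in> {0<..1} \<Longrightarrow> h n x = g n x" by metis
  have h': "(h n has_vector_derivative h (Suc n) x) (at x within {0..1})" if x: "x \<in> {0..1}" for n x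
  proof -
    \<comment> \<open>The interior form of the fundamental theorem asks for the derivative on the
      open interval only, so nothing is assumed at 0.\<close>
    have int: "(h (Suc n) has_integral h n y - h n 0) {0..y}" if "y \<in> {0..1}" for y
    proof (rule fundamental_theorem_of_calculus_interior)
      show "continuous_on {0..y} (h n)" by (rule continuous_on_subset[OF cont]) (use that in auto)
      fix z assume z: "z \<in> {0<..<y}"
      have "(g n has_vector_derivative g (Suc n) z) (at z within {0<..<1})"
        by (rule has_vector_derivative_within_subset[OF deriv]) (use z that in auto)
      then have "(g n has_vector_derivative g (Suc n) z) (at z)"
        using z that at_within_open[of z "{0<..<1}"] by simp
      then have "(h n has_vector_derivative g (Suc n) z) (at z)"
        by (rule has_vector_derivative_transform_within_open[of _ _ _ "{0<..<1}"])
          (use z that eq in auto)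
      then show "(h n has_vector_derivative h (Suc n) z) (at z)" using eq z that by simp
    qed (use that in auto)
    have "((\<lambda>y. h n 0 + integral {0..y} (h (Suc n))) has_vector_derivative 0 + h (Suc n) x)
        (at x within {0..1})"
      by (intro derivative_intros integral_has_vector_derivative cont x)
    then have "((\<lambda>y. h n 0 + integral {0..y} (h (Suc n))) has_vector_derivative h (Suc n) x)
        (at x within {0..1})" by simp
    then show ?thesis
      by (rule has_vector_derivative_transform[OF x, rotated]) (use integral_unique[OF int] in simp)
  qed
  show ?thesis
  proof
    show "smooth01 (h 0)" by (rule smooth01I[of h]) (use h' in auto)
    show "dn (h 0) n x = g n x" if "x \<in> {0<..1}" for n x
      using dn_eqI[of h "h 0" x n] h' that eq by auto
  qed
qed

text \<open>Convolution with the kernel \<rho>^m acts on l^2 with norm at most the l^1 norm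
  1/(1-\<rho>). Cauchy-Schwarz with the kernel split into two square roots gives one such factor,
  summing over n first gives the other.\<close>

lemma discrete_Young:
  fixes p :: "nat \<Rightarrow> real" and \<rho> :: real
  assumes "0 \<le> \<rho>" "\<rho> < 1"
  shows "(\<Sum>n\<le>N. (\<Sum>j\<le>n. \<rho> ^ (n - j) * p j)\<^sup>2) \<le> (1 / (1 - \<rho>))\<^sup>2 * (\<Sum>j\<le>N. (p j)\<^sup>2)"
proof -
  have geo: "(\<Sum>i\<le>m. \<rho> ^ i) \<le> 1 / (1 - \<rho>)" for m
    using assms by (simp add: sum_gp0 divide_right_mono)
  have CS: "(\<Sum>j\<le>n. \<rho> ^ (n - j) * p j)\<^sup>2 \<le> 1 / (1 - \<rho>) * (\<Sum>j\<le>n. \<rho> ^ (n - j) * (p j)\<^sup>2)" for n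
  proof -
    have "(\<Sum>j\<le>n. \<rho> ^ (n - j) * p j)\<^sup>2
        = (\<Sum>j\<le>n. sqrt (\<rho> ^ (n - j)) * (sqrt (\<rho> ^ (n - j)) * p j))\<^sup>2"
      using assms by (simp add: mult.assoc[symmetric])
    also have "\<dots> \<le> (\<Sum>j\<le>n. (sqrt (\<rho> ^ (n - j)))\<^sup>2) * (\<Sum>j\<le>n. (sqrt (\<rho> ^ (n - j)) * p j)\<^sup>2)"
      by (rule Cauchy_Schwarz_ineq_sum)
    also have "\<dots> = (\<Sum>j\<le>n. \<rho> ^ (n - j)) * (\<Sum>j\<le>n. \<rho> ^ (n - j) * (p j)\<^sup>2)"
      using assms by (simp add: power_mult_distrib)
    also have "(\<Sum>j\<le>n. \<rho> ^ (n - j)) = (\<Sum>i\<le>n. \<rho> ^ i)"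
      by (rule sum.nat_diff_reindex[of _ "Suc n", simplified lessThan_Suc_atMost, simplified])
    also have "(\<Sum>i\<le>n. \<rho> ^ i) * (\<Sum>j\<le>n. \<rho> ^ (n - j) * (p j)\<^sup>2)
        \<le> 1 / (1 - \<rho>) * (\<Sum>j\<le>n. \<rho> ^ (n - j) * (p j)\<^sup>2)"
      using assms by (intro mult_right_mono geo sum_nonneg) auto
    finally show ?thesis .
  qed
  have "(\<Sum>n\<le>N. (\<Sum>j\<le>n. \<rho> ^ (n - j) * p j)\<^sup>2)
      \<le> 1 / (1 - \<rho>) * (\<Sum>n\<le>N. \<Sum>j\<le>n. \<rho> ^ (n - j) * (p j)\<^sup>2)"
    unfolding sum_distrib_left by (intro sum_mono) (use CS in \<open>simp add: sum_distrib_left\<close>)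
  also have "(\<Sum>n\<le>N. \<Sum>j\<le>n. \<rho> ^ (n - j) * (p j)\<^sup>2) = (\<Sum>j\<le>N. \<Sum>n=j..N. \<rho> ^ (n - j) * (p j)\<^sup>2)"
  proof -
    have "{..n} = {j. j \<in> {..N} \<and> j \<le> n}" if "n \<in> {..N}" for n using that by auto
    moreover have "{j..N} = {n. n \<in> {..N} \<and> j \<le> n}" for j by auto
    ultimately show ?thesis
      using sum.swap_restrict[of "{..N}" "{..N}" "\<lambda>n j. \<rho> ^ (n - j) * (p j)\<^sup>2" "\<lambda>n j. j \<le> n"]
      by simp
  qed
  also have "\<dots> = (\<Sum>j\<le>N. (\<Sum>i\<le>N - j. \<rho> ^ i) * (p j)\<^sup>2)"
  proof (rule sum.cong[OF refl])
    fix j assume "j \<in> {..N}"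
    then have "(\<Sum>n=j..N. \<rho> ^ (n - j)) = (\<Sum>i\<le>N - j. \<rho> ^ i)"
      by (intro sum.reindex_bij_witness[of _ "\<lambda>i. i + j" "\<lambda>n. n - j"]) auto
    then show "(\<Sum>n=j..N. \<rho> ^ (n - j) * (p j)\<^sup>2) = (\<Sum>i\<le>N - j. \<rho> ^ i) * (p j)\<^sup>2"
      by (simp add: sum_distrib_right[symmetric])
  qed
  also have "\<dots> \<le> (\<Sum>j\<le>N. 1 / (1 - \<rho>) * (p j)\<^sup>2)"
    by (intro sum_mono mult_right_mono geo) auto
  also have "\<dots> = 1 / (1 - \<rho>) * (\<Sum>j\<le>N. (p j)\<^sup>2)" by (simp add: sum_distrib_left)
  finally show ?thesis using assms by (simp add: power2_eq_square mult_left_mono divide_right_mono)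
qed

section \<open>Truncated energies\<close>

definition weight :: "real \<Rightarrow> nat \<Rightarrow> real" where
  "weight \<sigma> n = \<sigma> ^ (2 * n) / ((fact n)\<^sup>2 * (fact (n + 1))\<^sup>2)"

text \<open>\<open>g n\<close> stands for the n-th derivative of psi, so v_n is
  \<open>g (Suc n)\<close>. The derivatives are an argument, not \<open>dn u\<close>, because for t
  > 0 they are at first known on (0,1] only. The factors n^k (x/\<sigma>)^k of
  \<open>semi_term\<close> are regrouped as (n/\<sigma>)^k x^k; as 0^0 = 1, only k = 0 survives
  among the integrals of order 0.\<close>

definition trunc_energy :: "real \<Rightarrow> nat \<Rightarrow> real \<Rightarrow> (nat \<Rightarrow> real \<Rightarrow> complex) \<Rightarrow> real" where
  "trunc_energy \<sigma> N a g =
     (\<Sum>n\<le>N. weight \<sigma> n *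
        ((\<Sum>k\<le>2. (real n / \<sigma>) ^ k * integral {a..1} (\<lambda>x. x ^ k * (cmod (g (Suc n) x))\<^sup>2))
         + \<sigma> * (cmod (g (Suc n) a))\<^sup>2))"

lemma weight_pos: "0 < \<sigma> \<Longrightarrow> 0 < weight \<sigma> n"
  by (simp add: weight_def)

lemma weight_0 [simp]: "weight \<sigma> 0 = 1"
  by (simp add: weight_def)

lemma weight_Suc: "weight \<sigma> (Suc n) * (real (Suc n) * real (Suc (Suc n)))\<^sup>2 = \<sigma>\<^sup>2 * weight \<sigma> n"
  by (simp add: weight_def power2_eq_square divide_simps del: of_nat_Suc)

text \<open>This pays for the coupling to v_{n-1}: by \<open>weight_Suc\<close> the squared
  coefficient n(n+1) is, up to \<sigma>^2, the ratio of consecutive weights. The factor n removes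
  the term n = 0, so nothing below v_0 is called for; a nonnegative term N+1 is added to make the
  shifted sum end at N.\<close>

lemma weight_shift_sum_le:
  assumes "0 < \<sigma>" and "\<And>n. 0 \<le> g n"
  shows "(\<Sum>n\<le>N. weight \<sigma> n * (real n * real (Suc n))\<^sup>2 * g n) \<le> \<sigma>\<^sup>2 * (\<Sum>n\<le>N. weight \<sigma> n * g (Suc n))"
proof -
  have "(\<Sum>n\<le>N. weight \<sigma> n * (real n * real (Suc n))\<^sup>2 * g n)
      \<le> (\<Sum>n\<le>Suc N. weight \<sigma> n * (real n * real (Suc n))\<^sup>2 * g n)"
    using assms by (intro sum_mono2) (auto simp: weight_pos less_imp_le)
  also have "\<dots> = (\<Sum>n\<le>N. weight \<sigma> (Suc n) * (real (Suc n) * real (Suc (Suc n)))\<^sup>2 * g (Suc n))"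
    by (simp only: sum.atMost_Suc_shift) simp
  also have "\<dots> = \<sigma>\<^sup>2 * (\<Sum>n\<le>N. weight \<sigma> n * g (Suc n))"
    by (simp only: weight_Suc sum_distrib_left mult.assoc)
  finally show ?thesis .
qed

lemma trunc_energy_0_eq:
  assumes "0 < \<sigma>"
  shows "trunc_energy \<sigma> N 0 (dn u) =
    (\<Sum>n\<le>N. semi_term \<sigma> 0 0 (dn u 1) n + semi_term \<sigma> 1 0 (dn u 1) n
            + semi_term \<sigma> 2 0 (dn u 1) n + bdry_term \<sigma> (dn u 1) n)"
  unfolding trunc_energy_def
proof (rule sum.cong[OF refl])
  fix n
  have semi: "semi_term \<sigma> k 0 (dn u 1) n =
      weight \<sigma> n * ((real n / \<sigma>) ^ k * integral {0..1} (\<lambda>x. x ^ k * (cmod (dn u (Suc n) x))\<^sup>2))" for k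
  proof -
    have "(\<lambda>x. (x / \<sigma>) ^ k * (cmod (dn u (Suc n) x))\<^sup>2)
        = (\<lambda>x. (1 / \<sigma> ^ k) * (x ^ k * (cmod (dn u (Suc n) x))\<^sup>2))"
      by (simp add: power_divide)
    then have "integral {0..1} (\<lambda>x. (x / \<sigma>) ^ k * (cmod (dn u (Suc n) x))\<^sup>2)
        = (1 / \<sigma> ^ k) * integral {0..1} (\<lambda>x. x ^ k * (cmod (dn u (Suc n) x))\<^sup>2)"
      by (simp only: integral_mult_right)
    then show ?thesis
      unfolding semi_term_def weight_def dn_Suc_shift by (simp add: power_divide)
  qed
  have bdry: "bdry_term \<sigma> (dn u 1) n = weight \<sigma> n * (\<sigma> * (cmod (dn u (Suc n) 0))\<^sup>2)"
    unfolding bdry_term_def weight_def dn_Suc_shift by simp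
  show "weight \<sigma> n *
        ((\<Sum>k\<le>2. (real n / \<sigma>) ^ k * integral {0..1} (\<lambda>x. x ^ k * (cmod (dn u (Suc n) x))\<^sup>2))
         + \<sigma> * (cmod (dn u (Suc n) 0))\<^sup>2) =
     semi_term \<sigma> 0 0 (dn u 1) n + semi_term \<sigma> 1 0 (dn u 1) n
            + semi_term \<sigma> 2 0 (dn u 1) n + bdry_term \<sigma> (dn u 1) n"
    unfolding semi bdry by (simp add: numeral_2_eq_2 algebra_simps)
qed

lemma trunc_energy_continuous:
  assumes "smooth01 u"
  shows "continuous_on {0..1} (\<lambda>a. trunc_energy \<sigma> N a (dn u))"
proof -
  note c = smooth01_continuous_on[OF assms]
  have "continuous_on {0..1} (\<lambda>a. integral {a..1} (\<lambda>x. x ^ k * (cmod (dn u (Suc n) x))\<^sup>2))" for k n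
    by (rule indefinite_integral_continuous_1')
       (intro integrable_continuous_real continuous_intros c)
  then show ?thesis unfolding trunc_energy_def by (intro continuous_intros c)
qed

lemma trunc_energy_cong:
  assumes "\<And>n x. x \<in> {a..1} \<Longrightarrow> g n x = h n x" "a \<le> 1"
  shows "trunc_energy \<sigma> N a g = trunc_energy \<sigma> N a h"
  unfolding trunc_energy_def
  using assms by (intro sum.cong arg_cong2[of _ _ _ _ "(*)"] arg_cong2[of _ _ _ _ "(+)"] integral_cong refl) auto

lemma trunc_energy_tendsto:
  assumes "smooth01 u" and "\<And>n x. x \<in> {0<..1} \<Longrightarrow> dn u n x = g n x"
  shows "((\<lambda>a. trunc_energy \<sigma> N a g) \<longlongrightarrow> trunc_energy \<sigma> N 0 (dn u)) (at_right 0)"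
proof -
  have "((\<lambda>a. trunc_energy \<sigma> N a (dn u)) \<longlongrightarrow> trunc_energy \<sigma> N 0 (dn u)) (at 0 within {0..1})"
    using trunc_energy_continuous[OF assms(1)] by (simp add: continuous_on)
  then have "((\<lambda>a. trunc_energy \<sigma> N a (dn u)) \<longlongrightarrow> trunc_energy \<sigma> N 0 (dn u)) (at_right 0)"
    by (simp add: at_within_Icc_at_right)
  moreover have "eventually (\<lambda>a. trunc_energy \<sigma> N a (dn u) = trunc_energy \<sigma> N a g) (at_right 0)"
  proof -
    have "eventually (\<lambda>a. a \<in> {0<..<1::real}) (at_right 0)" by (rule eventually_at_right_real) simp
    then show ?thesis by eventually_elim (intro trunc_energy_cong assms(2), auto)
  qed
  ultimately show ?thesis by (rule Lim_transform_eventually)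
qed

section \<open>The transport hierarchy\<close>

text \<open>Fixes the witness \<open>D\<close> of \<open>strip_solution\<close>. Equality of mixed
  derivatives is built into the indexing: \<open>D 1 (Suc n)\<close> is at once the t-derivative of
  \<open>D 0 (Suc n)\<close> and the x-derivative of \<open>D 1 n\<close>.\<close>

locale strip_wave =
  fixes W :: "real \<Rightarrow> complex" and D :: "nat \<Rightarrow> nat \<Rightarrow> real \<Rightarrow> real \<Rightarrow> complex"
  assumes W_smooth: "smooth01 W"
    and D_deriv: "\<And>i j p. p \<in> strip \<Longrightarrow>
          ((\<lambda>q. D i j (fst q) (snd q)) has_derivative
            (\<lambda>h. fst h *\<^sub>R D (Suc i) j (fst p) (snd p) + snd h *\<^sub>R D i (Suc j) (fst p) (snd p)))
          (at p within strip)"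
    and D_eq: "\<And>p. p \<in> strip \<Longrightarrow>
          complex_of_real ((snd p)\<^sup>2) * D 0 2 (fst p) (snd p)
          + complex_of_real (2 * snd p) * D 0 1 (fst p) (snd p)
          + D 1 1 (fst p) (snd p) - W (snd p) * D 0 0 (fst p) (snd p) = 0"
    and dirichlet: "\<And>t. 0 \<le> t \<Longrightarrow> D 0 0 t 1 = 0"
begin

text \<open>Leibniz expansion of d_x^n (W psi), kept as an explicit sum since its terms are later
  estimated one by one.\<close>

definition forcing :: "nat \<Rightarrow> real \<Rightarrow> real \<Rightarrow> complex" where
  "forcing n t x = (\<Sum>j\<le>n. of_nat (n choose j) * (dn W (n - j) x * D 0 j t x))"

lemma D_continuous_on: "continuous_on strip (\<lambda>q. D i j (fst q) (snd q))"
  using D_deriv has_derivative_continuous continuous_on_eq_continuous_within by blast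

lemma D_curve:
  assumes "t \<in> S" "S \<subseteq> {0..}" "\<And>s. s \<in> S \<Longrightarrow> a s \<in> {0<..1}"
    and a': "(a has_real_derivative a') (at t within S)"
  shows "((\<lambda>s. D i j s (a s)) has_vector_derivative
           D (Suc i) j t (a t) + a' *\<^sub>R D i (Suc j) t (a t)) (at t within S)"
proof -
  have 1: "((\<lambda>s. (s, a s)) has_derivative (\<lambda>h. (h, a' * h))) (at t within S)"
    using a' by (intro has_derivative_Pair has_derivative_ident) (simp add: has_field_derivative_def)
  have "(t, a t) \<in> strip" using assms by (auto simp: strip_def)
  note 2 = has_derivative_subset[OF D_deriv[OF this, of i j], of "(\<lambda>s. (s, a s)) ` S"]
  have "(\<lambda>s. (s, a s)) ` S \<subseteq> strip" using assms(2,3) by (auto simp: strip_def)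
  from has_derivative_in_compose[OF 1 2[OF this]] show ?thesis
    unfolding has_vector_derivative_def fst_conv snd_conv
    by (rule has_derivative_eq_rhs) (auto simp: algebra_simps)
qed

lemma D_t:
  assumes "t \<in> S" "S \<subseteq> {0..}" "x \<in> {0<..1}"
  shows "((\<lambda>s. D i j s x) has_vector_derivative D (Suc i) j t x) (at t within S)"
  using D_curve[of t S "\<lambda>_. x" 0 i j] assms by simp

lemma D_x:
  assumes "0 \<le> t" "x \<in> {0<..1}"
  shows "(D i j t has_vector_derivative D i (Suc j) t x) (at x within {0<..1})"
proof -
  have 1: "((\<lambda>y. (t, y)) has_derivative (\<lambda>h. (0, h))) (at x within {0<..1})"
    by (intro has_derivative_Pair has_derivative_ident has_derivative_const)
  have "(t, x) \<in> strip" using assms by (auto simp: strip_def)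
  note 2 = has_derivative_subset[OF D_deriv[OF this, of i j], of "(\<lambda>y. (t, y)) ` {0<..1}"]
  have "(\<lambda>y. (t, y)) ` {0<..1} \<subseteq> strip" using assms by (auto simp: strip_def)
  from has_derivative_in_compose[OF 1 2[OF this]] show ?thesis
    unfolding has_vector_derivative_def by simp
qed

lemma forcing_x:
  assumes "0 \<le> t" "x \<in> {0<..1}"
  shows "(forcing n t has_vector_derivative forcing (Suc n) t x) (at x within {0<..1})"
proof -
  have W: "(dn W m has_vector_derivative dn W (Suc m) x) (at x within {0<..1})" for m
    using W_smooth assms unfolding smooth01_def
    by (auto intro!: has_vector_derivative_within_subset[of _ _ _ "{0..1}" "{0<..1}"])
  have "(forcing n t has_vector_derivative
     (\<Sum>j\<le>n. of_nat (n choose j) * (dn W (n - j) x * D 0 (Suc j) t x + dn W (Suc (n - j)) x * D 0 j t x)))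
     (at x within {0<..1})"
    unfolding forcing_def by (intro derivative_intros W D_x assms)
  moreover have "(\<Sum>j\<le>n. of_nat (n choose j) *
      (dn W (n - j) x * D 0 (Suc j) t x + dn W (Suc (n - j)) x * D 0 j t x)) = forcing (Suc n) t x"
  proof -
    let ?w = "\<lambda>m. dn W m x" and ?d = "\<lambda>j. D 0 j t x"
    have "forcing (Suc n) t x = ?w (Suc n) * ?d 0
        + (\<Sum>j\<le>n. of_nat (Suc n choose Suc j) * (?w (n - j) * ?d (Suc j)))"
      unfolding forcing_def by (subst sum.atMost_Suc_shift) simp
    \<comment> \<open>Pascal's rule for \<open>Suc n choose Suc j\<close>; its two parts become the
      two halves of the product rule.\<close>
    also have "\<dots> = (\<Sum>j\<le>n. of_nat (n choose j) * (?w (n - j) * ?d (Suc j)))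
        + (?w (Suc n) * ?d 0 + (\<Sum>j\<le>n. of_nat (n choose Suc j) * (?w (n - j) * ?d (Suc j))))"
      by (simp del: dn.simps add: algebra_simps sum.distrib)
    also have "?w (Suc n) * ?d 0 + (\<Sum>j\<le>n. of_nat (n choose Suc j) * (?w (n - j) * ?d (Suc j)))
        = (\<Sum>j\<le>Suc n. of_nat (n choose j) * (?w (Suc n - j) * ?d j))"
      by (subst sum.atMost_Suc_shift) simp
    also have "\<dots> = (\<Sum>j\<le>n. of_nat (n choose j) * (?w (Suc (n - j)) * ?d j))"
      by (simp del: dn.simps add: Suc_diff_le binomial_eq_0)
    finally show ?thesis by (simp del: dn.simps add: algebra_simps sum.distrib)
  qed
  ultimately show ?thesis by simp
qed

text \<open>Order 0 is the given equation; each further order comes from differentiating in x. The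
  coefficients reproduce themselves since 2(n+1) + 2 = 2(n+2) and n(n+1) + 2(n+1) =
  (n+1)(n+2).\<close>

lemma transport:
  assumes "0 \<le> t" "x \<in> {0<..1}"
  shows "D 1 (Suc n) t x = forcing n t x - complex_of_real (x\<^sup>2) * D 0 (Suc (Suc n)) t x
      - of_nat (2 * (n + 1)) * (complex_of_real x * D 0 (Suc n) t x)
      - of_nat (n * (n + 1)) * D 0 n t x"
  using assms(2)
proof (induction n arbitrary: x)
  case 0
  then show ?case
    using D_eq[of "(t, x)"] assms by (simp add: strip_def forcing_def algebra_simps numeral_2_eq_2)
next
  case (Suc n)
  have sq: "((\<lambda>y. complex_of_real (y\<^sup>2)) has_vector_derivative of_real (2 * x)) (at x within {0<..1})"
    by (intro has_vector_derivative_of_real) (auto intro!: derivative_eq_intros)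
  have id: "((\<lambda>y. complex_of_real y) has_vector_derivative of_real 1) (at x within {0<..1})"
    by (intro has_vector_derivative_of_real) (auto intro!: derivative_eq_intros)
  have "((\<lambda>x. forcing n t x - complex_of_real (x\<^sup>2) * D 0 (Suc (Suc n)) t x
      - of_nat (2 * (n + 1)) * (complex_of_real x * D 0 (Suc n) t x)
      - of_nat (n * (n + 1)) * D 0 n t x) has_vector_derivative
    forcing (Suc n) t x
     - (complex_of_real (x\<^sup>2) * D 0 (Suc (Suc (Suc n))) t x + of_real (2 * x) * D 0 (Suc (Suc n)) t x)
     - of_nat (2 * (n + 1)) * (complex_of_real x * D 0 (Suc (Suc n)) t x + of_real 1 * D 0 (Suc n) t x)
     - of_nat (n * (n + 1)) * D 0 (Suc n) t x) (at x within {0<..1})" (is "(_ has_vector_derivative ?R) _")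
    by (intro derivative_intros sq id forcing_x D_x assms(1) Suc.prems)
  from has_vector_derivative_transform[OF Suc.prems Suc.IH this]
  have "(D 1 (Suc n) t has_vector_derivative ?R) (at x within {0<..1})" by simp
  moreover have "(D 1 (Suc n) t has_vector_derivative D 1 (Suc (Suc n)) t x) (at x within {0<..1})"
    by (rule D_x[OF assms(1) Suc.prems])
  moreover have "at x within {0<..1} \<noteq> bot"
    using Suc.prems by (auto simp: trivial_limit_within intro!: islimpt_closure_open[where s="{0<..<1}"])
  ultimately have "D 1 (Suc (Suc n)) t x = ?R"
    using vector_derivative_unique_within by blast
  then show ?case by (simp add: algebra_simps)
qed

end

section \<open>Estimates for a single order n\<close>

lemma two_inner_le: "2 * (u \<bullet> v) \<le> (norm u)\<^sup>2 + (norm v)\<^sup>2"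
  for u v :: "'a::real_inner"
  using norm_cauchy_schwarz[of u v] sum_squares_bound[of "norm u" "norm v"] by linarith

context strip_wave begin

lemma D_slice_continuous_on:
  assumes "0 \<le> t" "0 < b"
  shows "continuous_on {b..1} (D i j t)"
proof -
  have "continuous_on {b..1} (Pair t)" "Pair t ` {b..1} \<subseteq> strip"
    using assms by (auto intro!: continuous_intros simp: strip_def)
  from continuous_on_compose2[OF D_continuous_on this] show ?thesis by simp
qed

lemma forcing_slice_continuous_on:
  assumes "0 \<le> t" "0 < b"
  shows "continuous_on {b..1} (forcing n t)"
proof -
  have "continuous_on {b..1} (dn W m)" for m
    by (rule continuous_on_subset[OF smooth01_continuous_on[OF W_smooth]]) (use assms in auto)
  then show ?thesis
    unfolding forcing_def by (intro continuous_intros D_slice_continuous_on assms)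
qed

text \<open>By the Dirichlet condition psi(x) is minus the integral of its derivative over [x,1].
  This lets the energy, built from derivatives only, bound the psi that enters the forcing.\<close>

lemma norm_psi_le:
  assumes "0 \<le> t" "0 < b" "b \<le> x" "x \<le> 1"
  shows "(cmod (D 0 0 t x))\<^sup>2 \<le> integral {b..1} (\<lambda>y. (cmod (D 0 1 t y))\<^sup>2)"
proof -
  define m where "m = cmod (D 0 0 t x)"
  define I where "I = integral {x..1} (\<lambda>y. (cmod (D 0 1 t y))\<^sup>2)"
  have int: "(\<lambda>y. (cmod (D 0 1 t y))\<^sup>2) integrable_on {b..1}"
    "(\<lambda>y. (cmod (D 0 1 t y))\<^sup>2) integrable_on {x..1}"
    using assms by (intro integrable_continuous_real continuous_intros D_slice_continuous_on; simp)+
  have IB: "I \<le> integral {b..1} (\<lambda>y. (cmod (D 0 1 t y))\<^sup>2)"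
    unfolding I_def by (intro integral_subset_le int) (use assms in auto)
  have "m\<^sup>2 \<le> I"
  proof (cases "m = 0")
    case True
    have "0 \<le> I" unfolding I_def by (intro integral_nonneg int) simp
    then show ?thesis using True by simp
  next
    case False
    then have m: "0 < m" by (simp add: m_def)
    have "(D 0 1 t has_integral D 0 0 t 1 - D 0 0 t x) {x..1}"
    proof (rule fundamental_theorem_of_calculus)
      fix y assume "y \<in> {x..1}"
      then have "(D 0 0 t has_vector_derivative D 0 (Suc 0) t y) (at y within {0<..1})"
        using assms by (intro D_x) auto
      then show "(D 0 0 t has_vector_derivative D 0 1 t y) (at y within {x..1})"
        using assms by (auto intro: has_vector_derivative_within_subset)
    qed (use assms in auto)
    then have "D 0 0 t x = - integral {x..1} (D 0 1 t)"
      using dirichlet[of t] assms by (simp add: integral_unique)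
    then have "m = norm (integral {x..1} (D 0 1 t))" by (simp add: m_def)
    \<comment> \<open>Cauchy-Schwarz in disguise: the arithmetic-geometric mean inequality with
      parameter m, integrated over a length 1 - x <= 1, gives m <= m/2 + I/(2m).\<close>
    also have "\<dots> \<le> integral {x..1} (\<lambda>y. m / 2 + (1 / (2 * m)) * (cmod (D 0 1 t y))\<^sup>2)"
    proof (rule integral_norm_bound_integral)
      show "norm (D 0 1 t y) \<le> m / 2 + (1 / (2 * m)) * (cmod (D 0 1 t y))\<^sup>2" for y
      proof -
        have "2 * m * cmod (D 0 1 t y) \<le> m\<^sup>2 + (cmod (D 0 1 t y))\<^sup>2" by (rule sum_squares_bound)
        then show ?thesis using m by (simp add: field_simps power2_eq_square)
      qed
      show "D 0 1 t integrable_on {x..1}"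
        using assms by (intro integrable_continuous_real D_slice_continuous_on) auto
      show "(\<lambda>y. m / 2 + (1 / (2 * m)) * (cmod (D 0 1 t y))\<^sup>2) integrable_on {x..1}"
        using assms by (intro integrable_continuous_real continuous_intros D_slice_continuous_on) auto
    qed
    also have "\<dots> = (1 - x) * (m / 2) + (1 / (2 * m)) * I"
      unfolding I_def using assms integrable_on_mult_right[OF int(2), of "1 / (2 * m)"]
      by (subst integral_add) auto
    also have "\<dots> \<le> m / 2 + (1 / (2 * m)) * I"
      using m assms by (simp add: mult_left_le_one_le)
    finally show ?thesis using m by (simp add: field_simps power2_eq_square)
  qed
  with IB show ?thesis by (simp add: m_def)
qed

text \<open>The boundary curve is a characteristic, so the flux through it vanishes.\<close>
lemma energy_derivative:
  fixes a :: "real \<Rightarrow> real"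
  assumes p: "0 \<le> p" and d: "0 < d" and a: "\<And>s. s \<in> {p..q} \<Longrightarrow> a s \<in> {d..1}"
    and a': "(a has_real_derivative (a t)\<^sup>2) (at t within {p..q})"
    and t: "t \<in> {p..q}" and k: "k \<le> 2"
  shows "\<exists>y. ((\<lambda>s. integral {a s..1} (\<lambda>x. x ^ k * (cmod (D 0 (Suc n) s x))\<^sup>2)) has_real_derivative y)
              (at t within {p..q})
     \<and> y \<le> integral {a t..1} (\<lambda>x. x ^ k * (cmod (D 0 (Suc n) t x))\<^sup>2)
          + integral {a t..1} (\<lambda>x. (cmod (forcing n t x))\<^sup>2)
          + real n * real (Suc n) * ((cmod (D 0 n t (a t)))\<^sup>2
              + 2 * integral {a t..1} (\<lambda>x. (cmod (D 0 n t x))\<^sup>2))"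
proof -
  define F where "F s x = x ^ k * (D 0 (Suc n) s x \<bullet> D 0 (Suc n) s x)" for s x
  define F' where "F' s x = x ^ k * (2 * (D 0 (Suc n) s x \<bullet> D 1 (Suc n) s x))" for s x
  define P where "P = real n * real (Suc n)"
  have P0: "0 \<le> P" by (simp add: P_def)
  have t0: "0 \<le> t" using p t by auto
  have at: "0 < a t" "a t \<le> 1" using a[OF t] d by auto
  have sub: "{p..q} \<times> {d..1} \<subseteq> strip" using p d by (auto simp: strip_def)
  have Dc: "continuous_on ({p..q} \<times> {d..1}) (\<lambda>q. D i j (fst q) (snd q))" for i j
    by (rule continuous_on_subset[OF D_continuous_on sub])
  have deriv: "((\<lambda>s. integral {a s..1} (F s)) has_real_derivative
           integral {a t..1} (F' t) - (a t)\<^sup>2 * F t (a t)) (at t within {p..q})"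
  proof (rule has_real_derivative_integral_moving_lower[OF _ _ _ a a' t])
    fix s x assume "s \<in> {p..q}" "x \<in> {d..1}"
    then have "((\<lambda>s. D 0 (Suc n) s x) has_vector_derivative D 1 (Suc n) s x) (at s within {p..q})"
      using D_t[of s "{p..q}" x 0 "Suc n"] p d by auto
    then have "((\<lambda>s. D 0 (Suc n) s x) has_derivative (\<lambda>h. h *\<^sub>R D 1 (Suc n) s x)) (at s within {p..q})"
      by (simp add: has_vector_derivative_def)
    then have "((\<lambda>s. x ^ k * (D 0 (Suc n) s x \<bullet> D 0 (Suc n) s x)) has_derivative
      (\<lambda>h. x ^ k * (D 0 (Suc n) s x \<bullet> h *\<^sub>R D 1 (Suc n) s x + h *\<^sub>R D 1 (Suc n) s x \<bullet> D 0 (Suc n) s x)))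
      (at s within {p..q})"
      by (intro has_derivative_mult_right has_derivative_inner)
    then show "((\<lambda>t. F t x) has_real_derivative F' s x) (at s within {p..q})"
      unfolding has_field_derivative_def F_def F'_def
      by (rule has_derivative_eq_rhs) (auto simp: algebra_simps inner_commute)
  next
    show "continuous_on ({p..q} \<times> {d..1}) (\<lambda>(t, x). F t x)"
      "continuous_on ({p..q} \<times> {d..1}) (\<lambda>(t, x). F' t x)"
      unfolding F_def F'_def split_beta by (intro continuous_intros Dc)+
  qed auto
  \<comment> \<open>\<open>H\<close> is the flux: adding its derivative to \<open>F'\<close> cancels
    the products U.U' and U.V, where U = v_n and V = v_{n-1}. The first summand of
    \<open>H (a t)\<close> is exactly the loss a^2 F caused by the moving endpoint.\<close>
  define H where "H x = x ^ (k + 2) * (D 0 (Suc n) t x \<bullet> D 0 (Suc n) t x)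
      + P * (x ^ k * (D 0 n t x \<bullet> D 0 n t x))" for x
  define H' where "H' x = real (k + 2) * x ^ (k + 1) * (D 0 (Suc n) t x \<bullet> D 0 (Suc n) t x)
      + x ^ (k + 2) * (2 * (D 0 (Suc n) t x \<bullet> D 0 (Suc (Suc n)) t x))
      + P * (real k * x ^ (k - 1) * (D 0 n t x \<bullet> D 0 n t x)
             + x ^ k * (2 * (D 0 n t x \<bullet> D 0 (Suc n) t x)))" for x
  define R where "R x = x ^ k * (cmod (D 0 (Suc n) t x))\<^sup>2 + (cmod (forcing n t x))\<^sup>2
      + 2 * P * (cmod (D 0 n t x))\<^sup>2" for x
  have H_int: "(H' has_integral H 1 - H (a t)) {a t..1}"
  proof (rule fundamental_theorem_of_calculus)
    fix x assume x: "x \<in> {a t..1}"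
    have Dx: "(D 0 j t has_derivative (\<lambda>h. h *\<^sub>R D 0 (Suc j) t x)) (at x within {a t..1})" for j
    proof -
      have "x \<in> {0<..1}" "{a t..1} \<subseteq> {0<..1}" using x at by auto
      then show ?thesis
        using has_vector_derivative_within_subset[OF D_x[OF t0]] unfolding has_vector_derivative_def
        by blast
    qed
    have inner': "((\<lambda>x. D 0 j t x \<bullet> D 0 j t x) has_real_derivative
        2 * (D 0 j t x \<bullet> D 0 (Suc j) t x)) (at x within {a t..1})" for j
      unfolding has_field_derivative_def
      by (rule has_derivative_eq_rhs[OF has_derivative_inner[OF Dx Dx]])
         (auto simp: algebra_simps inner_commute)
    have pw: "((\<lambda>x. x ^ m) has_real_derivative real m * x ^ (m - 1)) (at x within {a t..1})" for m
      by (auto intro!: derivative_eq_intros)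
    have "(H has_real_derivative H' x) (at x within {a t..1})"
      unfolding H_def H'_def
      by (rule DERIV_cong[OF DERIV_add[OF DERIV_mult[OF pw inner'] DERIV_cmult[OF DERIV_mult[OF pw inner']]]])
         (simp add: algebra_simps)
    then show "(H has_vector_derivative H' x) (at x within {a t..1})"
      by (simp add: has_real_derivative_iff_has_vector_derivative)
  qed (use at in auto)
  have cont: "continuous_on {a t..1} (D i j t)" for i j by (rule D_slice_continuous_on[OF t0 at(1)])
  have fcont: "continuous_on {a t..1} (forcing n t)" by (rule forcing_slice_continuous_on[OF t0 at(1)])
  have "(F' t has_integral integral {a t..1} (F' t)) {a t..1}"
    unfolding F'_def
    by (intro integrable_integral integrable_continuous_real continuous_intros cont)
  from has_integral_add[OF this H_int]
  have FH_int: "((\<lambda>x. F' t x + H' x) has_integral (integral {a t..1} (F' t) + (H 1 - H (a t)))) {a t..1}" .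
  have R_int: "(R has_integral
      (integral {a t..1} (\<lambda>x. x ^ k * (cmod (D 0 (Suc n) t x))\<^sup>2)
          + integral {a t..1} (\<lambda>x. (cmod (forcing n t x))\<^sup>2)
          + 2 * P * integral {a t..1} (\<lambda>x. (cmod (D 0 n t x))\<^sup>2))) {a t..1}"
    unfolding R_def
    by (intro has_integral_add has_integral_mult_right integrable_integral integrable_continuous_real
        continuous_intros cont fcont)
  have FH_R: "F' t x + H' x \<le> R x" if x: "x \<in> {a t..1}" for x
  proof -
    have x01: "x \<in> {0<..1}" using x at by auto
    let ?U = "D 0 (Suc n) t x" and ?U' = "D 0 (Suc (Suc n)) t x" and ?V = "D 0 n t x"
      and ?f = "forcing n t x"
    have "D 1 (Suc n) t x = ?f - x\<^sup>2 *\<^sub>R ?U' - (2 * (real n + 1) * x) *\<^sub>R ?U - P *\<^sub>R ?V"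
      using transport[OF t0 x01, of n] by (simp add: P_def scaleR_conv_of_real algebra_simps)
    then have F'_eq: "F' t x = x ^ k * (2 * (?U \<bullet> ?f - x\<^sup>2 * (?U \<bullet> ?U')
        - 2 * (real n + 1) * x * (?U \<bullet> ?U) - P * (?U \<bullet> ?V)))"
      by (simp add: F'_def inner_diff_right)
    have "F' t x + H' x = x ^ k * (2 * (?U \<bullet> ?f))
        + (real k + 2 - 4 * (real n + 1)) * x ^ (k + 1) * (?U \<bullet> ?U)
        + P * (real k * x ^ (k - 1) * (?V \<bullet> ?V))"
      unfolding F'_eq H'_def by (simp add: algebra_simps power2_eq_square inner_commute)
    also have "\<dots> \<le> (x ^ k * (cmod ?U)\<^sup>2 + (cmod ?f)\<^sup>2) + 0 + P * (2 * (cmod ?V)\<^sup>2)"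
    proof (intro add_mono)
      have xk: "0 \<le> x ^ k" "x ^ k \<le> 1" using x01 by (auto simp: power_le_one)
      have "x ^ k * (2 * (?U \<bullet> ?f)) \<le> x ^ k * ((cmod ?U)\<^sup>2 + (cmod ?f)\<^sup>2)"
        using xk by (intro mult_left_mono two_inner_le)
      also have "\<dots> \<le> x ^ k * (cmod ?U)\<^sup>2 + (cmod ?f)\<^sup>2"
        using xk by (simp add: distrib_left mult_left_le_one_le)
      finally show "x ^ k * (2 * (?U \<bullet> ?f)) \<le> x ^ k * (cmod ?U)\<^sup>2 + (cmod ?f)\<^sup>2" .
      \<comment> \<open>The coefficient is largest for k = 2 and n = 0, where it is 0; here k <= 2
        lets the damping 2(n+1) x v_n win.\<close>
      show "(real k + 2 - 4 * (real n + 1)) * x ^ (k + 1) * (?U \<bullet> ?U) \<le> 0"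
        using k x01 by (intro mult_nonpos_nonneg) auto
      \<comment> \<open>For k = 0 the truncated exponent k - 1 is 0, and the factor k makes the term
        vanish.\<close>
      have "real k * x ^ (k - 1) \<le> 2 * 1"
        using k x01 by (intro mult_mono) (auto simp: power_le_one)
      then show "P * (real k * x ^ (k - 1) * (?V \<bullet> ?V)) \<le> P * (2 * (cmod ?V)\<^sup>2)"
        using P0 by (intro mult_left_mono) (auto simp: dot_square_norm intro!: mult_right_mono)
    qed
    also have "\<dots> = R x" by (simp add: R_def)
    finally show ?thesis .
  qed
  have "integral {a t..1} (F' t) + (H 1 - H (a t)) \<le>
      integral {a t..1} (\<lambda>x. x ^ k * (cmod (D 0 (Suc n) t x))\<^sup>2)
          + integral {a t..1} (\<lambda>x. (cmod (forcing n t x))\<^sup>2)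
          + 2 * P * integral {a t..1} (\<lambda>x. (cmod (D 0 n t x))\<^sup>2)"
    by (rule has_integral_le[OF FH_int R_int FH_R])
  \<comment> \<open>The flux at x = 1 leaves the domain and enters with a favourable sign.\<close>
  moreover have "0 \<le> H 1" using P0 by (simp add: H_def)
  moreover have "H (a t) - (a t)\<^sup>2 * F t (a t) \<le> P * (cmod (D 0 n t (a t)))\<^sup>2"
  proof -
    have "H (a t) - (a t)\<^sup>2 * F t (a t) = P * ((a t) ^ k * (cmod (D 0 n t (a t)))\<^sup>2)"
      by (simp add: H_def F_def power_add dot_square_norm power2_eq_square)
    also have "\<dots> \<le> P * (cmod (D 0 n t (a t)))\<^sup>2"
      using P0 at by (intro mult_left_mono) (auto simp: mult_left_le_one_le power_le_one)
    finally show ?thesis .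
  qed
  ultimately show ?thesis
    using deriv unfolding F_def dot_square_norm P_def[symmetric]
    by (intro exI[of _ "integral {a t..1} (F' t) - (a t)\<^sup>2 * F t (a t)"])
       (simp add: F_def dot_square_norm algebra_simps)
qed

text \<open>Along the characteristic the terms with v_{n+1} cancel, so the value at the curve obeys
  an ordinary differential equation in t. The mixed term is split with parameter \<sigma>: after
  multiplication by the energy factor \<sigma> \<open>weight \<sigma> n\<close> and summation, both
  halves cost at most \<sigma>^2 times the same boundary sum.\<close>

lemma boundary_derivative:
  fixes a :: "real \<Rightarrow> real"
  assumes p: "0 \<le> p" and a: "\<And>s. s \<in> {p..q} \<Longrightarrow> a s \<in> {0<..1}"
    and a': "(a has_real_derivative (a t)\<^sup>2) (at t within {p..q})"
    and t: "t \<in> {p..q}" and \<sigma>: "0 < \<sigma>"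
  shows "\<exists>y. ((\<lambda>s. (cmod (D 0 (Suc n) s (a s)))\<^sup>2) has_real_derivative y) (at t within {p..q})
     \<and> y \<le> (1 + \<sigma>) * (cmod (D 0 (Suc n) t (a t)))\<^sup>2 + (cmod (forcing n t (a t)))\<^sup>2
          + (real n * real (Suc n))\<^sup>2 / \<sigma> * (cmod (D 0 n t (a t)))\<^sup>2"
proof -
  define P where "P = real n * real (Suc n)"
  let ?U = "D 0 (Suc n) t (a t)" and ?U' = "D 0 (Suc (Suc n)) t (a t)" and ?V = "D 0 n t (a t)"
    and ?f = "forcing n t (a t)"
  define G where "G = ?f - (2 * (real n + 1) * a t) *\<^sub>R ?U - P *\<^sub>R ?V"
  have t0: "0 \<le> t" using p t by auto
  have at: "a t \<in> {0<..1}" using a[OF t] .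
  have "((\<lambda>s. D 0 (Suc n) s (a s)) has_vector_derivative D 1 (Suc n) t (a t) + (a t)\<^sup>2 *\<^sub>R ?U') (at t within {p..q})"
    using D_curve[OF t _ a a', of 0 "Suc n"] p by auto
  moreover have "D 1 (Suc n) t (a t) + (a t)\<^sup>2 *\<^sub>R ?U' = G"
    using transport[OF t0 at, of n] by (simp add: G_def P_def scaleR_conv_of_real algebra_simps)
  ultimately have "((\<lambda>s. D 0 (Suc n) s (a s)) has_derivative (\<lambda>h. h *\<^sub>R G)) (at t within {p..q})"
    by (simp add: has_vector_derivative_def)
  then have "((\<lambda>s. D 0 (Suc n) s (a s) \<bullet> D 0 (Suc n) s (a s)) has_real_derivative 2 * (?U \<bullet> G)) (at t within {p..q})"
    unfolding has_field_derivative_def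
    by (intro has_derivative_eq_rhs[OF has_derivative_inner])
       (auto simp: algebra_simps inner_commute)
  moreover have "2 * (?U \<bullet> G) \<le> (1 + \<sigma>) * (cmod ?U)\<^sup>2 + (cmod ?f)\<^sup>2 + P\<^sup>2 / \<sigma> * (cmod ?V)\<^sup>2"
  proof -
    have 1: "2 * (?U \<bullet> ?f) \<le> (cmod ?U)\<^sup>2 + (cmod ?f)\<^sup>2" by (rule two_inner_le)
    have "0 \<le> (\<sigma> *\<^sub>R ?U + P *\<^sub>R ?V) \<bullet> (\<sigma> *\<^sub>R ?U + P *\<^sub>R ?V)" by simp
    also have "\<dots> = \<sigma> * (\<sigma> * (cmod ?U)\<^sup>2 + 2 * P * (?U \<bullet> ?V) + P\<^sup>2 / \<sigma> * (cmod ?V)\<^sup>2)"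
      unfolding power2_norm_eq_inner
      using \<sigma> by (simp add: inner_add_left inner_add_right inner_commute algebra_simps power2_eq_square)
    finally have 2: "0 \<le> \<sigma> * (cmod ?U)\<^sup>2 + 2 * P * (?U \<bullet> ?V) + P\<^sup>2 / \<sigma> * (cmod ?V)\<^sup>2"
      using \<sigma> by (simp add: zero_le_mult_iff)
    \<comment> \<open>The term 2(n+1) x v_n only damps and is dropped.\<close>
    have 3: "0 \<le> 4 * (real n + 1) * a t * (?U \<bullet> ?U)" using at by simp
    show ?thesis using 1 2 3 unfolding G_def by (simp add: inner_diff_right algebra_simps)
  qed
  ultimately show ?thesis unfolding dot_square_norm P_def by blast
qed

end

section \<open>Gronwall estimate for Gevrey potentials\<close>

text \<open>The case in which all derivatives fall on W; it stands apart because the remaining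
  factor psi has no weight of its own.\<close>

lemma gevrey_coefficient_0:
  assumes "0 < \<sigma>" "0 < \<sigma>s"
  shows "real (Suc n) * (\<sigma> ^ n / (fact n * fact (Suc n))) * ((fact n)\<^sup>2 / \<sigma>s ^ n) = (\<sigma> / \<sigma>s) ^ n"
  using assms by (simp add: field_simps power2_eq_square power_divide del: of_nat_Suc)

text \<open>The term with v_i and m derivatives on W, so n = i + m + 1. The factor n+1 turns n!
  (n+1)! into (n!)^2, the binomial coefficient takes one n! and one m!, and i! m! <= n! does the
  rest. What remains is the geometric kernel (\<sigma>/\<sigma>s)^m.\<close>

lemma gevrey_coefficient_Suc:
  assumes "0 < \<sigma>" "0 < \<sigma>s"
  shows "real (Suc (i + m + 1)) * (\<sigma> ^ (i + m + 1) / (fact (i + m + 1) * fact (Suc (i + m + 1))))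
      * (real ((i + m + 1) choose Suc i) * ((fact m)\<^sup>2 / \<sigma>s ^ m))
    \<le> (\<sigma> / \<sigma>s) ^ m * (\<sigma> * (\<sigma> ^ i / (fact i * fact (Suc i))))"
proof -
  define n where "n = i + m + 1"
  have bin: "real (n choose Suc i) = fact n / (fact (Suc i) * fact m)"
    unfolding n_def by (subst binomial_fact) auto
  have "(fact i * fact m :: real) \<le> fact (i + m)"
  proof -
    have "fact i * fact m \<le> (fact (i + m) :: nat)"
      using fact_fact_dvd_fact[of i m, where 'a=nat] by (auto intro: dvd_imp_le)
    then show ?thesis by (metis of_nat_fact of_nat_le_iff of_nat_mult)
  qed
  also have "\<dots> \<le> fact n" unfolding n_def by (rule fact_mono) simp
  finally have le: "(fact i * fact m :: real) \<le> fact n" .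
  have "real (Suc n) * (\<sigma> ^ n / (fact n * fact (Suc n)))
      * (real (n choose Suc i) * ((fact m)\<^sup>2 / \<sigma>s ^ m))
    = (\<sigma> ^ n / \<sigma>s ^ m / fact (Suc i)) * (fact m / fact n)"
    unfolding bin by (simp add: field_simps power2_eq_square del: of_nat_Suc)
  also have "\<dots> \<le> (\<sigma> ^ n / \<sigma>s ^ m / fact (Suc i)) * (1 / fact i)"
    using assms le by (intro mult_left_mono) (simp_all add: field_simps)
  also have "\<dots> = (\<sigma> / \<sigma>s) ^ m * (\<sigma> * (\<sigma> ^ i / (fact i * fact (Suc i))))"
    unfolding n_def using assms by (simp add: field_simps power_add power_divide del: of_nat_Suc fact_Suc)
  finally show ?thesis unfolding n_def by simp
qed

lemma weight_eq_square: "weight \<sigma> n = (\<sigma> ^ n / (fact n * fact (Suc n)))\<^sup>2"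
  by (simp add: weight_def power_divide power_mult_distrib power_mult[symmetric] mult.commute del: fact_Suc)

locale gevrey_strip_wave = strip_wave +
  fixes \<sigma> \<sigma>s C :: real
  assumes \<sigma>: "0 < \<sigma>" "\<sigma> < \<sigma>s"
    and C: "0 \<le> C"
    and W_bound: "\<And>n x. x \<in> {0<..1} \<Longrightarrow> cmod (dn W n x) \<le> C * ((fact n)\<^sup>2 / \<sigma>s ^ n)"
begin

text \<open>C^2 times the squared l^1 norm of the kernel (\<sigma>/\<sigma>s)^m, as delivered by
  \<open>discrete_Young\<close>.\<close>

definition K :: real where
  "K = (C / (1 - \<sigma> / \<sigma>s))\<^sup>2"

text \<open>Read off from the end of \<open>trunc_energy_derivative\<close>: 1 stands for the
  squares of v_n that reproduce the energy, s (\<sigma> + 2 \<sigma>^2) for the coupling to v_{n-1}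
  and s K (1 + \<sigma>^2) for the forcing in the interior, 2 \<sigma> and \<sigma> K (1 + \<sigma>)
  for the same two on the curve.\<close>

definition growth_rate :: real where
  "growth_rate = (let s = (\<Sum>k\<le>2. (1 / \<sigma>) ^ k) in
     1 + s * (\<sigma> + 2 * \<sigma>\<^sup>2) + s * K * (1 + \<sigma>\<^sup>2) + 2 * \<sigma> + \<sigma> * K * (1 + \<sigma>))"

lemma K_nonneg: "0 \<le> K" by (simp add: K_def)

text \<open>Pointwise in x the weighted forcing is dominated by a convolution with
  (\<sigma>/\<sigma>s)^m, to which \<open>discrete_Young\<close> applies. The additional (n+1)^2 on
  the left later pays for n^k with k <= 2.\<close>

lemma forcing_bound:
  assumes t: "0 \<le> t" and x: "x \<in> {0<..1}"
  shows "(\<Sum>n\<le>N. (real (Suc n))\<^sup>2 * weight \<sigma> n * (cmod (forcing n t x))\<^sup>2)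
    \<le> K * ((cmod (D 0 0 t x))\<^sup>2 + \<sigma>\<^sup>2 * (\<Sum>n\<le>N. weight \<sigma> n * (cmod (D 0 (Suc n) t x))\<^sup>2))"
proof -
  define r where "r n = \<sigma> ^ n / (fact n * fact (Suc n))" for n
  \<comment> \<open>Entry 0 is psi, entry i+1 is v_i with the square root of its weight; the extra
    \<sigma> arises because n = i + m + 1 has one power more than i and m together.\<close>
  define p where "p j = (case j of 0 \<Rightarrow> cmod (D 0 0 t x) | Suc i \<Rightarrow> \<sigma> * (r i * cmod (D 0 (Suc i) t x)))" for j
  define \<rho> where "\<rho> = \<sigma> / \<sigma>s"
  have \<rho>: "0 \<le> \<rho>" "\<rho> < 1" using \<sigma> by (auto simp: \<rho>_def)
  have r0: "0 \<le> r n" for n using \<sigma> by (simp add: r_def)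
  have coeff: "real (Suc n) * r n * (real (n choose j) * ((fact (n - j))\<^sup>2 / \<sigma>s ^ (n - j))) * cmod (D 0 j t x)
      \<le> \<rho> ^ (n - j) * p j" if "j \<le> n" for n j
  proof (cases j)
    case 0
    then show ?thesis
      using gevrey_coefficient_0[of \<sigma> \<sigma>s n] \<sigma> by (simp add: r_def p_def \<rho>_def)
  next
    case (Suc i)
    define m where "m = n - j"
    have n: "n = i + m + 1" using that Suc by (simp add: m_def)
    have "real (Suc n) * r n * (real (n choose j) * ((fact m)\<^sup>2 / \<sigma>s ^ m)) \<le> \<rho> ^ m * (\<sigma> * r i)"
      using gevrey_coefficient_Suc[of \<sigma> \<sigma>s i m] \<sigma> unfolding n Suc r_def \<rho>_def by simp
    then have "real (Suc n) * r n * (real (n choose j) * ((fact m)\<^sup>2 / \<sigma>s ^ m)) * cmod (D 0 j t x)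
        \<le> \<rho> ^ m * (\<sigma> * r i) * cmod (D 0 j t x)"
      by (rule mult_right_mono) simp
    then show ?thesis by (simp add: m_def p_def Suc mult.assoc)
  qed
  have pt: "real (Suc n) * r n * cmod (forcing n t x) \<le> C * (\<Sum>j\<le>n. \<rho> ^ (n - j) * p j)" for n
  proof -
    have "cmod (forcing n t x) \<le> (\<Sum>j\<le>n. real (n choose j) * (C * ((fact (n - j))\<^sup>2 / \<sigma>s ^ (n - j)) * cmod (D 0 j t x)))"
      unfolding forcing_def
      by (rule sum_norm_le)
         (simp only: norm_mult norm_of_nat, intro mult_left_mono mult_right_mono W_bound x; simp)
    then have "real (Suc n) * r n * cmod (forcing n t x)
        \<le> real (Suc n) * r n * (\<Sum>j\<le>n. real (n choose j) * (C * ((fact (n - j))\<^sup>2 / \<sigma>s ^ (n - j)) * cmod (D 0 j t x)))"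
      using r0 by (intro mult_left_mono) auto
    also have "\<dots> = C * (\<Sum>j\<le>n. real (Suc n) * r n * (real (n choose j) * ((fact (n - j))\<^sup>2 / \<sigma>s ^ (n - j))) * cmod (D 0 j t x))"
      unfolding sum_distrib_left by (intro sum.cong refl) (simp add: mult_ac)
    also have "\<dots> \<le> C * (\<Sum>j\<le>n. \<rho> ^ (n - j) * p j)"
      using C coeff by (intro mult_left_mono sum_mono) auto
    finally show ?thesis .
  qed
  have "(\<Sum>n\<le>N. (real (Suc n))\<^sup>2 * weight \<sigma> n * (cmod (forcing n t x))\<^sup>2)
      = (\<Sum>n\<le>N. (real (Suc n) * r n * cmod (forcing n t x))\<^sup>2)"
    by (simp only: weight_eq_square r_def power_mult_distrib)
  also have "\<dots> \<le> (\<Sum>n\<le>N. (C * (\<Sum>j\<le>n. \<rho> ^ (n - j) * p j))\<^sup>2)"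
    using r0 by (intro sum_mono power_mono pt) auto
  also have "\<dots> = C\<^sup>2 * (\<Sum>n\<le>N. (\<Sum>j\<le>n. \<rho> ^ (n - j) * p j)\<^sup>2)"
    unfolding power_mult_distrib by (rule sum_distrib_left[symmetric])
  also have "\<dots> \<le> C\<^sup>2 * ((1 / (1 - \<rho>))\<^sup>2 * (\<Sum>j\<le>N. (p j)\<^sup>2))"
    by (intro mult_left_mono discrete_Young \<rho>) simp
  also have "\<dots> = K * (\<Sum>j\<le>N. (p j)\<^sup>2)" by (simp add: K_def \<rho>_def power_divide)
  \<comment> \<open>The sum up to N stops at v_{N-1}; one more term is added to reach v_N.\<close>
  also have "\<dots> \<le> K * (\<Sum>j\<le>Suc N. (p j)\<^sup>2)"
    by (intro mult_left_mono K_nonneg) simp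
  also have "(\<Sum>j\<le>Suc N. (p j)\<^sup>2) = (cmod (D 0 0 t x))\<^sup>2 + \<sigma>\<^sup>2 * (\<Sum>n\<le>N. weight \<sigma> n * (cmod (D 0 (Suc n) t x))\<^sup>2)"
    by (simp only: sum.atMost_Suc_shift)
       (simp only: p_def nat.case power_mult_distrib weight_eq_square r_def sum_distrib_left)
  finally show ?thesis .
qed

text \<open>All coupling and forcing terms are charged to two parts of the energy: Z, the integrals
  with k = 0, and \<sigma> B, the boundary part. The integrals with k = 1, 2 merely reproduce
  themselves.\<close>

lemma trunc_energy_derivative:
  fixes a :: "real \<Rightarrow> real"
  assumes p: "0 \<le> p" and d: "0 < d" and a: "\<And>s. s \<in> {p..q} \<Longrightarrow> a s \<in> {d..1}"
    and a': "(a has_real_derivative (a t)\<^sup>2) (at t within {p..q})"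
    and t: "t \<in> {p..q}"
  shows "\<exists>y. ((\<lambda>s. trunc_energy \<sigma> N (a s) (\<lambda>n. D 0 n s)) has_real_derivative y) (at t within {p..q})
     \<and> y \<le> growth_rate * trunc_energy \<sigma> N (a t) (\<lambda>n. D 0 n t)"
proof -
  define I where "I k n = integral {a t..1} (\<lambda>x. x ^ k * (cmod (D 0 (Suc n) t x))\<^sup>2)" for k n
  define V where "V n = integral {a t..1} (\<lambda>x. (cmod (D 0 n t x))\<^sup>2)" for n
  define J where "J n = integral {a t..1} (\<lambda>x. (cmod (forcing n t x))\<^sup>2)" for n
  define b where "b n = (cmod (D 0 n t (a t)))\<^sup>2" for n
  define f where "f n = (cmod (forcing n t (a t)))\<^sup>2" for n
  define P where "P n = real n * real (Suc n)" for n
  define s where "s = (\<Sum>k\<le>2. (1 / \<sigma>) ^ k)"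
  define E where "E = trunc_energy \<sigma> N (a t) (\<lambda>n. D 0 n t)"
  define B where "B = (\<Sum>n\<le>N. weight \<sigma> n * b (Suc n))"
  define Z where "Z = (\<Sum>n\<le>N. weight \<sigma> n * V (Suc n))"
  define w where "w = weight \<sigma>"
  have t0: "0 \<le> t" using p t by auto
  have at: "0 < a t" "a t \<le> 1" "a t \<in> {0<..1}" using a[OF t] d by auto
  have cont: "continuous_on {a t..1} (D i j t)" for i j by (rule D_slice_continuous_on[OF t0 at(1)])
  have fcont: "continuous_on {a t..1} (forcing n t)" for n by (rule forcing_slice_continuous_on[OF t0 at(1)])
  have Int: "(\<lambda>x. x ^ k * (cmod (D 0 n t x))\<^sup>2) integrable_on {a t..1}"
    "(\<lambda>x. (cmod (D 0 n t x))\<^sup>2) integrable_on {a t..1}"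
    "(\<lambda>x. (cmod (forcing n t x))\<^sup>2) integrable_on {a t..1}" for k n
    by (intro integrable_continuous_real continuous_intros cont fcont)+
  have w0: "0 \<le> w n" for n using weight_pos[OF \<sigma>(1)] by (simp add: w_def less_imp_le)
  have nonneg: "0 \<le> I k n" "0 \<le> V n" "0 \<le> J n" "0 \<le> b n" "0 \<le> f n" "0 \<le> P n" for k n
    unfolding I_def V_def J_def b_def f_def P_def
    using at by (auto intro!: integral_nonneg Int)
  have I0: "I 0 n = V (Suc n)" for n by (simp add: I_def V_def)
  have s0: "0 \<le> s" using \<sigma> by (auto simp: s_def intro!: sum_nonneg)
  have E_eq: "E = (\<Sum>n\<le>N. w n * ((\<Sum>k\<le>2. (real n / \<sigma>) ^ k * I k n) + \<sigma> * b (Suc n)))"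
    by (simp add: E_def trunc_energy_def I_def b_def w_def)
  have V_le: "V (Suc n) \<le> (\<Sum>k\<le>2. (real n / \<sigma>) ^ k * I k n)" for n
  proof -
    have "(\<Sum>k\<in>{0}. (real n / \<sigma>) ^ k * I k n) \<le> (\<Sum>k\<le>2. (real n / \<sigma>) ^ k * I k n)"
      using \<sigma> nonneg by (intro sum_mono2) auto
    then show ?thesis by (simp add: I0)
  qed
  have ZB: "Z + \<sigma> * B \<le> E"
  proof -
    have "Z + \<sigma> * B = (\<Sum>n\<le>N. w n * (V (Suc n) + \<sigma> * b (Suc n)))"
      by (simp add: Z_def B_def w_def sum_distrib_left sum.distrib[symmetric] algebra_simps)
    also have "\<dots> \<le> E" unfolding E_eq using V_le by (intro sum_mono mult_left_mono w0) auto
    finally show ?thesis .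
  qed
  have Z0: "0 \<le> Z" and B0: "0 \<le> B"
    unfolding Z_def B_def w_def[symmetric] by (auto intro!: sum_nonneg mult_nonneg_nonneg w0 nonneg)
  have ZE: "Z \<le> E" and BE: "\<sigma> * B \<le> E"
    using ZB Z0 mult_nonneg_nonneg[OF less_imp_le[OF \<sigma>(1)] B0] by linarith+

  define Q1 where "Q1 k n y \<longleftrightarrow>
      ((\<lambda>s. integral {a s..1} (\<lambda>x. x ^ k * (cmod (D 0 (Suc n) s x))\<^sup>2)) has_real_derivative y)
        (at t within {p..q}) \<and> y \<le> I k n + J n + P n * (b n + 2 * V n)" for k n y
  have "\<exists>y. Q1 k n y" if "k \<le> 2" for k n
    using energy_derivative[OF p d a a' t that, of n] unfolding Q1_def I_def J_def P_def b_def V_def .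
  then obtain y1 where "\<And>k n. k \<le> 2 \<Longrightarrow> Q1 k n (y1 k n)" by metis
  then have y1: "k \<le> 2 \<Longrightarrow>
      ((\<lambda>s. integral {a s..1} (\<lambda>x. x ^ k * (cmod (D 0 (Suc n) s x))\<^sup>2)) has_real_derivative y1 k n)
        (at t within {p..q})"
    and y1_le: "k \<le> 2 \<Longrightarrow> y1 k n \<le> I k n + J n + P n * (b n + 2 * V n)" for k n
    unfolding Q1_def by blast+
  have a01: "\<And>s. s \<in> {p..q} \<Longrightarrow> a s \<in> {0<..1}" using a d by fastforce
  define Q2 where "Q2 n y \<longleftrightarrow>
      ((\<lambda>s. (cmod (D 0 (Suc n) s (a s)))\<^sup>2) has_real_derivative y) (at t within {p..q})
      \<and> y \<le> (1 + \<sigma>) * b (Suc n) + f n + (P n)\<^sup>2 / \<sigma> * b n" for n y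
  have "\<exists>y. Q2 n y" for n
    using boundary_derivative[OF p a01 a' t \<sigma>(1), of n] unfolding Q2_def f_def P_def b_def .
  then obtain y2 where "\<And>n. Q2 n (y2 n)" by metis
  then have y2: "((\<lambda>s. (cmod (D 0 (Suc n) s (a s)))\<^sup>2) has_real_derivative y2 n) (at t within {p..q})"
    and y2_le: "y2 n \<le> (1 + \<sigma>) * b (Suc n) + f n + (P n)\<^sup>2 / \<sigma> * b n" for n
    unfolding Q2_def by blast+
  define y where "y = (\<Sum>n\<le>N. w n * ((\<Sum>k\<le>2. (real n / \<sigma>) ^ k * y1 k n) + \<sigma> * y2 n))"
  have deriv: "((\<lambda>s. trunc_energy \<sigma> N (a s) (\<lambda>n. D 0 n s)) has_real_derivative y) (at t within {p..q})"
    unfolding trunc_energy_def y_def w_def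
    by (intro DERIV_sum DERIV_cmult DERIV_add y1 y2) auto

  \<comment> \<open>For k <= 2, n^k is at most (n+1)^2, and at most n(n+1) when n > 0; at n = 0,
    where 0^0 = 1, the vanishing of \<open>P 0\<close> takes over.\<close>
  have pw: "(real n / \<sigma>) ^ k * P n \<le> (1 / \<sigma>) ^ k * (P n)\<^sup>2"
       "(real n / \<sigma>) ^ k \<le> (1 / \<sigma>) ^ k * (real (Suc n))\<^sup>2" if "k \<le> 2" for k n
  proof -
    have "real n ^ k \<le> real (Suc n) ^ k" by (intro power_mono) auto
    also have "\<dots> \<le> real (Suc n) ^ 2" by (intro power_increasing that) auto
    finally have 1: "real n ^ k \<le> (real (Suc n))\<^sup>2" .
    show "(real n / \<sigma>) ^ k \<le> (1 / \<sigma>) ^ k * (real (Suc n))\<^sup>2"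
      using 1 \<sigma> by (simp add: power_divide divide_right_mono del: of_nat_Suc)
    have "real n ^ k * P n \<le> (P n)\<^sup>2"
    proof (cases "n = 0")
      case True
      then show ?thesis by (simp add: P_def)
    next
      case False
      have "real n ^ k \<le> real n ^ 2" using False that by (intro power_increasing) auto
      also have "\<dots> \<le> P n" by (simp add: P_def power2_eq_square algebra_simps)
      finally show ?thesis using nonneg(6)[of n] by (simp add: power2_eq_square mult_right_mono)
    qed
    then show "(real n / \<sigma>) ^ k * P n \<le> (1 / \<sigma>) ^ k * (P n)\<^sup>2"
      using \<sigma> by (simp add: power_divide divide_right_mono)
  qed
  have y1_sum: "(\<Sum>k\<le>2. (real n / \<sigma>) ^ k * y1 k n)
      \<le> (\<Sum>k\<le>2. (real n / \<sigma>) ^ k * I k n) + s * ((real (Suc n))\<^sup>2 * J n) + s * ((P n)\<^sup>2 * (b n + 2 * V n))" for n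
  proof -
    have "(\<Sum>k\<le>2. (real n / \<sigma>) ^ k * y1 k n)
      \<le> (\<Sum>k\<le>2. (real n / \<sigma>) ^ k * I k n + (1 / \<sigma>) ^ k * ((real (Suc n))\<^sup>2 * J n)
           + (1 / \<sigma>) ^ k * ((P n)\<^sup>2 * (b n + 2 * V n)))"
    proof (rule sum_mono)
      fix k :: nat assume "k \<in> {..2}"
      then have k: "k \<le> 2" by simp
      have "(real n / \<sigma>) ^ k * y1 k n \<le> (real n / \<sigma>) ^ k * (I k n + J n + P n * (b n + 2 * V n))"
        using \<sigma> by (intro mult_left_mono y1_le k) auto
      also have "\<dots> = (real n / \<sigma>) ^ k * I k n + (real n / \<sigma>) ^ k * J n
          + (real n / \<sigma>) ^ k * P n * (b n + 2 * V n)"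
        by (simp add: distrib_left mult.assoc)
      also have "\<dots> \<le> (real n / \<sigma>) ^ k * I k n + (1 / \<sigma>) ^ k * (real (Suc n))\<^sup>2 * J n
          + (1 / \<sigma>) ^ k * (P n)\<^sup>2 * (b n + 2 * V n)"
        using nonneg by (intro add_mono mult_right_mono pw k) auto
      finally show "(real n / \<sigma>) ^ k * y1 k n \<le> (real n / \<sigma>) ^ k * I k n + (1 / \<sigma>) ^ k * ((real (Suc n))\<^sup>2 * J n)
           + (1 / \<sigma>) ^ k * ((P n)\<^sup>2 * (b n + 2 * V n))" by (simp add: mult.assoc)
    qed
    then show ?thesis by (simp only: sum.distrib sum_distrib_right[symmetric] s_def)
  qed
  have "y \<le> (\<Sum>n\<le>N. w n * (((\<Sum>k\<le>2. (real n / \<sigma>) ^ k * I k n) + s * ((real (Suc n))\<^sup>2 * J n)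
        + s * ((P n)\<^sup>2 * (b n + 2 * V n))) + \<sigma> * ((1 + \<sigma>) * b (Suc n) + f n + (P n)\<^sup>2 / \<sigma> * b n)))"
    unfolding y_def using \<sigma> by (intro sum_mono mult_left_mono add_mono w0 y1_sum y2_le) auto
  also have "\<dots> = (\<Sum>n\<le>N. w n * ((\<Sum>k\<le>2. (real n / \<sigma>) ^ k * I k n) + \<sigma> * b (Suc n))
      + s * ((real (Suc n))\<^sup>2 * w n * J n) + s * (w n * (P n)\<^sup>2 * (b n + 2 * V n))
      + \<sigma>\<^sup>2 * (w n * b (Suc n)) + \<sigma> * (w n * f n) + w n * (P n)\<^sup>2 * b n)"
    using \<sigma> by (intro sum.cong refl) (simp add: algebra_simps power2_eq_square)
  also have "\<dots> = E + s * (\<Sum>n\<le>N. (real (Suc n))\<^sup>2 * w n * J n)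
      + s * (\<Sum>n\<le>N. w n * (P n)\<^sup>2 * (b n + 2 * V n))
      + \<sigma>\<^sup>2 * B + \<sigma> * (\<Sum>n\<le>N. w n * f n) + (\<Sum>n\<le>N. w n * (P n)\<^sup>2 * b n)"
    unfolding E_eq B_def w_def by (simp only: sum.distrib sum_distrib_left)
  also have "\<dots> \<le> E + s * (K * (1 + \<sigma>\<^sup>2) * Z) + s * (\<sigma>\<^sup>2 * (B + 2 * Z))
      + \<sigma>\<^sup>2 * B + \<sigma> * (K * (Z + \<sigma>\<^sup>2 * B)) + \<sigma>\<^sup>2 * B"
  proof (intro add_mono mult_left_mono order_refl s0)
    \<comment> \<open>Order 0 has weight 1, so its integral is one summand of Z.\<close>
    have psi: "(cmod (D 0 0 t x))\<^sup>2 \<le> Z" if "x \<in> {a t..1}" for x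
    proof -
      have "(cmod (D 0 0 t x))\<^sup>2 \<le> V (Suc 0)"
        using norm_psi_le[OF t0 at(1), of x] that by (simp add: V_def)
      also have "\<dots> = (\<Sum>n\<in>{0}. w n * V (Suc n))" by (simp add: w_def)
      also have "\<dots> \<le> Z" unfolding Z_def w_def[symmetric] by (intro sum_mono2) (auto intro!: mult_nonneg_nonneg w0 nonneg)
      finally show ?thesis .
    qed
    show "(\<Sum>n\<le>N. (real (Suc n))\<^sup>2 * w n * J n) \<le> K * (1 + \<sigma>\<^sup>2) * Z"
    proof -
      have "((\<lambda>x. \<Sum>n\<le>N. (real (Suc n))\<^sup>2 * w n * (cmod (forcing n t x))\<^sup>2) has_integral
          (\<Sum>n\<le>N. (real (Suc n))\<^sup>2 * w n * J n)) {a t..1}"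
        unfolding J_def by (intro has_integral_sum has_integral_mult_right integrable_integral Int) auto
      moreover have "((\<lambda>x. K * (Z + \<sigma>\<^sup>2 * (\<Sum>n\<le>N. w n * (cmod (D 0 (Suc n) t x))\<^sup>2))) has_integral
          K * ((1 - a t) * Z + \<sigma>\<^sup>2 * (\<Sum>n\<le>N. w n * V (Suc n)))) {a t..1}"
        unfolding V_def using at has_integral_const_real[of Z "a t" 1]
        by (intro has_integral_sum has_integral_mult_right has_integral_add integrable_integral Int) auto
      moreover have "(\<Sum>n\<le>N. (real (Suc n))\<^sup>2 * w n * (cmod (forcing n t x))\<^sup>2)
          \<le> K * (Z + \<sigma>\<^sup>2 * (\<Sum>n\<le>N. w n * (cmod (D 0 (Suc n) t x))\<^sup>2))" if "x \<in> {a t..1}" for x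
      proof -
        have "x \<in> {0<..1}" using that at by auto
        from forcing_bound[OF t0 this, of N] show ?thesis
          unfolding w_def
          by (rule order_trans) (intro mult_left_mono add_mono psi that K_nonneg order_refl)
      qed
      ultimately have "(\<Sum>n\<le>N. (real (Suc n))\<^sup>2 * w n * J n)
          \<le> K * ((1 - a t) * Z + \<sigma>\<^sup>2 * (\<Sum>n\<le>N. w n * V (Suc n)))"
        by (rule has_integral_le)
      also have "\<dots> \<le> K * (Z + \<sigma>\<^sup>2 * Z)"
        unfolding Z_def[symmetric] w_def using at Z0
        by (intro mult_left_mono add_mono K_nonneg) (auto simp: mult_left_le_one_le)
      finally show ?thesis by (simp add: algebra_simps)
    qed
    have "(\<Sum>n\<le>N. w n * (P n)\<^sup>2 * (b n + 2 * V n)) \<le> \<sigma>\<^sup>2 * (\<Sum>n\<le>N. w n * (b (Suc n) + 2 * V (Suc n)))"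
      unfolding w_def P_def using weight_shift_sum_le[OF \<sigma>(1), of "\<lambda>n. b n + 2 * V n" N] nonneg by simp
    also have "(\<Sum>n\<le>N. w n * (b (Suc n) + 2 * V (Suc n))) = B + 2 * Z"
      by (simp add: B_def Z_def w_def distrib_left sum.distrib sum_distrib_left mult_ac)
    finally show "(\<Sum>n\<le>N. w n * (P n)\<^sup>2 * (b n + 2 * V n)) \<le> \<sigma>\<^sup>2 * (B + 2 * Z)" .
    show "(\<Sum>n\<le>N. w n * (P n)\<^sup>2 * b n) \<le> \<sigma>\<^sup>2 * B"
      unfolding w_def P_def B_def using weight_shift_sum_le[OF \<sigma>(1), of b N] nonneg by simp
    \<comment> \<open>On the curve the forcing comes without the factor (n+1)^2; inserting it makes
      \<open>forcing_bound\<close> applicable.\<close>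
    have "(\<Sum>n\<le>N. w n * f n) \<le> (\<Sum>n\<le>N. (real (Suc n))\<^sup>2 * w n * f n)"
    proof (rule sum_mono)
      fix n
      have "1 \<le> (real (Suc n))\<^sup>2" by (simp add: one_le_power)
      from mult_right_mono[OF this mult_nonneg_nonneg[OF w0 nonneg(5)]]
      show "w n * f n \<le> (real (Suc n))\<^sup>2 * w n * f n" by (simp only: mult_1 mult.assoc)
    qed
    also have "\<dots> \<le> K * ((cmod (D 0 0 t (a t)))\<^sup>2 + \<sigma>\<^sup>2 * B)"
      unfolding f_def w_def B_def b_def by (rule forcing_bound[OF t0 at(3)])
    also have "\<dots> \<le> K * (Z + \<sigma>\<^sup>2 * B)"
      using psi[of "a t"] at by (intro mult_left_mono add_mono K_nonneg) auto
    finally show "(\<Sum>n\<le>N. w n * f n) \<le> K * (Z + \<sigma>\<^sup>2 * B)" .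
  qed (use \<sigma> in auto)
  also have "\<dots> = E + s * K * (1 + \<sigma>\<^sup>2) * Z + s * \<sigma> * (\<sigma> * B) + s * (2 * \<sigma>\<^sup>2) * Z
      + 2 * \<sigma> * (\<sigma> * B) + \<sigma> * K * Z + \<sigma> * K * \<sigma> * (\<sigma> * B)"
    by (simp add: algebra_simps power2_eq_square)
  also have "\<dots> \<le> E + s * K * (1 + \<sigma>\<^sup>2) * E + s * \<sigma> * E + s * (2 * \<sigma>\<^sup>2) * E
      + 2 * \<sigma> * E + \<sigma> * K * E + \<sigma> * K * \<sigma> * E"
    using \<sigma> s0 K_nonneg by (intro add_mono mult_left_mono ZE BE order_refl) auto
  also have "\<dots> = growth_rate * E"
    by (simp add: growth_rate_def s_def[symmetric] Let_def algebra_simps)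
  finally show ?thesis using deriv unfolding E_def by blast
qed

text \<open>Gronwall's argument along the characteristic that ends at (t2, \<epsilon>), with a
  decaying exponential as integrating factor.\<close>

lemma trunc_energy_growth:
  assumes "0 \<le> t1" "t1 \<le> t2" "0 < \<epsilon>" "\<epsilon> \<le> 1"
  shows "trunc_energy \<sigma> N \<epsilon> (\<lambda>n. D 0 n t2)
     \<le> exp (growth_rate * (t2 - t1)) * trunc_energy \<sigma> N (\<epsilon> / (1 + \<epsilon> * (t2 - t1))) (\<lambda>n. D 0 n t1)"
proof -
  define a where "a t = \<epsilon> / (1 + \<epsilon> * (t2 - t))" for t
  \<comment> \<open>\<open>d\<close> is a(t1), the least value of the curve, so everything happens
    on a compact rectangle inside the strip.\<close>
  define d where "d = \<epsilon> / (1 + \<epsilon> * (t2 - t1))"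
  define E where "E t = trunc_energy \<sigma> N (a t) (\<lambda>n. D 0 n t)" for t
  have pos: "1 \<le> 1 + \<epsilon> * (t2 - t)" if "t \<in> {t1..t2}" for t using that assms by simp
  have d: "0 < d" unfolding d_def using less_le_trans[OF zero_less_one pos, of t1] assms by simp
  have a: "a t \<in> {d..1}" if "t \<in> {t1..t2}" for t
  proof -
    have "\<epsilon> * (t2 - t) \<le> \<epsilon> * (t2 - t1)" using that assms by (intro mult_left_mono) auto
    then have "d \<le> a t"
      unfolding a_def d_def using less_le_trans[OF zero_less_one pos[OF that]] assms
      by (intro frac_le) auto
    moreover have "a t \<le> 1" using pos[OF that] assms by (simp add: a_def divide_le_eq)
    ultimately show ?thesis by simp
  qed
  have a': "(a has_real_derivative (a t)\<^sup>2) (at t within {t1..t2})" if "t \<in> {t1..t2}" for t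
    unfolding a_def using pos[OF that]
    by (auto intro!: derivative_eq_intros simp: power2_eq_square)
  define G where "G t = exp (- growth_rate * t) * E t" for t
  have G': "\<exists>y. (G has_real_derivative y) (at t within {t1..t2}) \<and> y \<le> 0" if t: "t \<in> {t1..t2}" for t
  proof -
    obtain y where y: "(E has_real_derivative y) (at t within {t1..t2})" "y \<le> growth_rate * E t"
      using trunc_energy_derivative[OF assms(1) d a a'[OF t] t, of N] unfolding E_def by auto
    have "(G has_real_derivative exp (- growth_rate * t) * (y - growth_rate * E t)) (at t within {t1..t2})"
      unfolding G_def by (auto intro!: derivative_eq_intros y simp: algebra_simps)
    then show ?thesis using y(2) by (auto intro!: exI mult_nonneg_nonpos)
  qed
  have "G t2 \<le> G t1"
  proof (rule DERIV_nonpos_imp_decreasing_open[OF assms(2)])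
    show "\<exists>y. DERIV G x :> y \<and> y \<le> 0" if "t1 < x" "x < t2" for x
      using G'[of x] at_within_Icc_at[OF that] that by auto
    show "continuous_on {t1..t2} G"
      using G' DERIV_continuous unfolding continuous_on_eq_continuous_within by blast
  qed
  then have "E t2 \<le> exp (growth_rate * (t2 - t1)) * E t1"
    unfolding G_def by (simp add: exp_minus exp_diff right_diff_distrib field_simps)
  then show ?thesis by (simp add: E_def a_def)
qed

end

section \<open>Passage to the full norm\<close>

text \<open>The analogue of \<open>dn_eqI\<close> without the point 0, where the solution carries no
  information; it gives a smooth extension the derivatives of the solution on (0,1].\<close>

lemma dn_agree:
  assumes "smooth01 u" and "\<And>x. x \<in> {0<..1} \<Longrightarrow> u x = g 0 x"
    and "\<And>n x. x \<in> {0<..1} \<Longrightarrow> (g n has_vector_derivative g (Suc n) x) (at x within {0<..1})"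
    and "x \<in> {0<..1}"
  shows "dn u n x = g n x"
  using assms(4)
proof (induction n arbitrary: x)
  case 0
  then show ?case using assms(2) by simp
next
  case (Suc n)
  have "x \<in> {0..1}" using Suc.prems by auto
  then have "(dn u n has_vector_derivative dn u (Suc n) x) (at x within {0<..1})"
    using assms(1) unfolding smooth01_def
    by (auto intro!: has_vector_derivative_within_subset[of _ _ _ "{0..1}" "{0<..1}"])
  moreover have "(dn u n has_vector_derivative g (Suc n) x) (at x within {0<..1})"
    by (rule has_vector_derivative_transform[OF Suc.prems _ assms(3)[OF Suc.prems]]) (rule Suc.IH)
  moreover have "at x within {0<..1} \<noteq> bot"
    using Suc.prems by (auto simp: trivial_limit_within intro!: islimpt_closure_open[where s="{0<..<1}"])
  ultimately show ?case using vector_derivative_unique_within by blast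
qed

lemma semi_term_nonneg:
  assumes "0 < \<sigma>" "smooth01 u"
  shows "0 \<le> semi_term \<sigma> k l (dn u 1) n"
proof -
  have "0 \<le> integral {0..1} (\<lambda>x. (x / \<sigma>) ^ k * (cmod (dn (dn u 1) n x))\<^sup>2)"
    unfolding dn_Suc_shift using assms
    by (intro integral_nonneg integrable_continuous_real continuous_intros smooth01_continuous_on) auto
  then show ?thesis unfolding semi_term_def using assms by simp
qed

lemma bdry_term_nonneg: "0 < \<sigma> \<Longrightarrow> 0 \<le> bdry_term \<sigma> v n"
  by (simp add: bdry_term_def)

lemma Xnorm_nonneg:
  assumes "0 < \<sigma>" "u \<in> Xsig \<sigma>"
  shows "0 \<le> Xnorm \<sigma> u"
  using assms semi_term_nonneg[OF assms(1)] bdry_term_nonneg[OF assms(1)]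
  unfolding Xnorm_def Xsig_def mem_Collect_eq
  by (intro real_sqrt_ge_zero add_nonneg_nonneg suminf_nonneg) blast+

lemma trunc_energy_LIMSEQ:
  assumes "0 < \<sigma>" "u \<in> Xsig \<sigma>"
  shows "(\<lambda>N. trunc_energy \<sigma> N 0 (dn u)) \<longlonglongrightarrow> (Xnorm \<sigma> u)\<^sup>2"
    and "trunc_energy \<sigma> N 0 (dn u) \<le> (Xnorm \<sigma> u)\<^sup>2"
proof -
  let ?f = "\<lambda>n. semi_term \<sigma> 0 0 (dn u 1) n + semi_term \<sigma> 1 0 (dn u 1) n
            + semi_term \<sigma> 2 0 (dn u 1) n + bdry_term \<sigma> (dn u 1) n"
  have u: "smooth01 u" "summable (semi_term \<sigma> 0 0 (dn u 1))" "summable (semi_term \<sigma> 1 0 (dn u 1))"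
      "summable (semi_term \<sigma> 2 0 (dn u 1))" "summable (bdry_term \<sigma> (dn u 1))"
    using assms(2) unfolding Xsig_def by blast+
  note nn = semi_term_nonneg[OF assms(1) u(1)] bdry_term_nonneg[OF assms(1)]
  have "(Xnorm \<sigma> u)\<^sup>2 = (\<Sum>n. semi_term \<sigma> 0 0 (dn u 1) n) + (\<Sum>n. semi_term \<sigma> 1 0 (dn u 1) n)
            + (\<Sum>n. semi_term \<sigma> 2 0 (dn u 1) n) + (\<Sum>n. bdry_term \<sigma> (dn u 1) n)"
    unfolding Xnorm_def by (rule real_sqrt_pow2) (intro add_nonneg_nonneg suminf_nonneg u nn)
  then have sums: "?f sums (Xnorm \<sigma> u)\<^sup>2"
    by (simp only:) (intro sums_add summable_sums u)
  then show "(\<lambda>N. trunc_energy \<sigma> N 0 (dn u)) \<longlonglongrightarrow> (Xnorm \<sigma> u)\<^sup>2"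
    unfolding trunc_energy_0_eq[OF assms(1)] sums_def_le .
  show "trunc_energy \<sigma> N 0 (dn u) \<le> (Xnorm \<sigma> u)\<^sup>2"
    unfolding trunc_energy_0_eq[OF assms(1)] sums_unique[OF sums]
    by (intro sum_le_suminf sums_summable[OF sums] add_nonneg_nonneg nn) auto
qed

text \<open>All four series have nonnegative terms, so a bound on the partial sums of their total
  bounds each of them.\<close>

lemma XsigI:
  assumes \<sigma>: "0 < \<sigma>" and u: "smooth01 u" "u 1 = 0" and B: "\<And>N. trunc_energy \<sigma> N 0 (dn u) \<le> B"
  shows "u \<in> Xsig \<sigma>"
proof -
  note nn = semi_term_nonneg[OF \<sigma> u(1)] bdry_term_nonneg[OF \<sigma>]
  have *: "summable f" if "\<And>n. 0 \<le> f n" and "\<And>n. f n \<le> semi_term \<sigma> 0 0 (dn u 1) n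
      + semi_term \<sigma> 1 0 (dn u 1) n + semi_term \<sigma> 2 0 (dn u 1) n + bdry_term \<sigma> (dn u 1) n" for f
  proof (rule bounded_imp_summable[OF that(1)])
    show "sum f {..N} \<le> B" for N
      using B[of N] sum_mono[of "{..N}" f, OF that(2)] unfolding trunc_energy_0_eq[OF \<sigma>] by linarith
  qed
  show ?thesis
    unfolding Xsig_def mem_Collect_eq
  proof (intro conjI u)
    show "summable (semi_term \<sigma> 0 0 (dn u 1))" "summable (semi_term \<sigma> 1 0 (dn u 1))"
      "summable (semi_term \<sigma> 2 0 (dn u 1))" "summable (bdry_term \<sigma> (dn u 1))"
      by (rule *; simp add: nn del: dn.simps One_nat_def)+
  qed
qed

text \<open>X is not known to be continuous. Measurability, and with it integrability, comes from
  the monotonicity of g = e^{-ct} X; the inequality comes from integrating X(s) >= e^{cs}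
  g(t2).\<close>

lemma exponential_growth_integral:
  fixes X :: "real \<Rightarrow> real"
  assumes c: "0 \<le> c" and X0: "\<And>t. t \<in> {t1..t2} \<Longrightarrow> 0 \<le> X t"
    and X: "\<And>s t. t1 \<le> s \<Longrightarrow> s \<le> t \<Longrightarrow> t \<le> t2 \<Longrightarrow> X t \<le> exp (c * (t - s)) * X s"
    and t: "t1 \<le> t2"
  shows "X integrable_on {t1..t2} \<and> X t2 - X t1 \<le> c * integral {t1..t2} X"
proof -
  define g where "g t = exp (- c * t) * X t" for t
  have g_anti: "g t \<le> g s" if "t1 \<le> s" "s \<le> t" "t \<le> t2" for s t
  proof -
    have "exp (- c * t) * X t \<le> exp (- c * t) * (exp (c * (t - s)) * X s)"
      by (intro mult_left_mono X that) simp
    also have "\<dots> = exp (- c * s) * X s"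
      by (simp add: mult.assoc[symmetric] exp_add[symmetric] algebra_simps)
    finally show ?thesis by (simp add: g_def)
  qed
  have X_eq: "X t = exp (c * t) * g t" for t
    by (simp add: g_def exp_minus mult.assoc[symmetric])
  have "mono_on {t1..t2} (\<lambda>t. - g t)" using g_anti by (auto simp: mono_on_def)
  then have "(\<lambda>t. - g t) \<in> borel_measurable (lebesgue_on {t1..t2})"
    using integrable_mono_on borel_measurable_integrable by blast
  then have "(\<lambda>t. - (- g t)) \<in> borel_measurable (lebesgue_on {t1..t2})" by measurable
  then have "g \<in> borel_measurable (lebesgue_on {t1..t2})" by simp
  moreover have "(\<lambda>t. exp (c * t)) \<in> borel_measurable (lebesgue_on {t1..t2})"
    by (intro continuous_imp_measurable_on_sets_lebesgue continuous_intros) auto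
  ultimately have "(\<lambda>t. exp (c * t) * g t) \<in> borel_measurable (lebesgue_on {t1..t2})"
    by (intro borel_measurable_times)
  then have meas: "X \<in> borel_measurable (lebesgue_on {t1..t2})" by (simp add: X_eq[symmetric])
  have int: "X integrable_on {t1..t2}"
  proof (rule measurable_bounded_by_integrable_imp_integrable[OF meas])
    show "(\<lambda>s. exp (c * (t2 - t1)) * X t1) integrable_on {t1..t2}" by (rule integrable_const_ivl)
    fix s assume s: "s \<in> {t1..t2}"
    have "X s \<le> exp (c * (s - t1)) * X t1" using s by (intro X) auto
    also have "\<dots> \<le> exp (c * (t2 - t1)) * X t1"
      using s c X0[of t1] by (intro mult_right_mono) (auto intro!: mult_left_mono)
    finally show "norm (X s) \<le> exp (c * (t2 - t1)) * X t1" using X0[OF s] by simp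
  qed auto
  \<comment> \<open>With g frozen at its least value g(t2) the comparison function has an explicit
    primitive.\<close>
  have "((\<lambda>s. c * exp (c * s) * g t2) has_integral exp (c * t2) * g t2 - exp (c * t1) * g t2) {t1..t2}"
    by (rule fundamental_theorem_of_calculus[OF t])
       (auto intro!: derivative_eq_intros simp: has_real_derivative_iff_has_vector_derivative[symmetric])
  moreover have "((\<lambda>s. c * X s) has_integral c * integral {t1..t2} X) {t1..t2}"
    by (intro has_integral_mult_right integrable_integral int)
  moreover have "c * exp (c * s) * g t2 \<le> c * X s" if "s \<in> {t1..t2}" for s
    unfolding X_eq mult.assoc using that c by (intro mult_left_mono g_anti) auto
  ultimately have "exp (c * t2) * g t2 - exp (c * t1) * g t2 \<le> c * integral {t1..t2} X"
    by (rule has_integral_le)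
  moreover have "exp (c * t1) * g t2 \<le> exp (c * t1) * g t1"
    using t by (intro mult_left_mono g_anti) auto
  ultimately have "X t2 - X t1 \<le> c * integral {t1..t2} X" unfolding X_eq[symmetric] by linarith
  with int show ?thesis by blast
qed

text \<open>The definition bounds the derivatives on (0,1) only; continuity adds x = 1, which
  belongs to every interval [a,1] of integration.\<close>

lemma gevrey_regular_bound:
  assumes "gevrey_regular \<sigma>s 2 W"
  obtains C where "0 \<le> C" "\<And>n x. x \<in> {0<..1} \<Longrightarrow> cmod (dn W n x) \<le> C * ((fact n)\<^sup>2 / \<sigma>s ^ n)"
proof -
  obtain C where C: "C > 0" and W: "smooth01 W"
    and b: "\<And>n x. x \<in> {0<..<1} \<Longrightarrow> cmod (dn W n x) \<le> C / \<sigma>s ^ n * (fact n) powr 2"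
    using assms unfolding gevrey_regular_def by blast
  have b': "cmod (dn W n x) \<le> C * ((fact n)\<^sup>2 / \<sigma>s ^ n)" if "x \<in> {0<..<1}" for n x
    using b[OF that, of n] by (simp add: powr_numeral)
  have "cmod (dn W n 1) \<le> C * ((fact n)\<^sup>2 / \<sigma>s ^ n)" for n
  proof (rule tendsto_upperbound)
    have "(dn W n \<longlongrightarrow> dn W n 1) (at 1 within {0..1})"
      using smooth01_continuous_on[OF W] by (simp add: continuous_on)
    then show "((\<lambda>x. cmod (dn W n x)) \<longlongrightarrow> cmod (dn W n 1)) (at_left 1)"
      by (intro tendsto_norm) (simp add: at_within_Icc_at_left)
    have "\<forall>\<^sub>F x in at_left 1. x \<in> {0<..<1::real}" by (rule eventually_at_left_real) simp
    then show "\<forall>\<^sub>F x in at_left 1. cmod (dn W n x) \<le> C * ((fact n)\<^sup>2 / \<sigma>s ^ n)"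
      by eventually_elim (rule b')
  qed simp
  with b' have "cmod (dn W n x) \<le> C * ((fact n)\<^sup>2 / \<sigma>s ^ n)" if "x \<in> {0<..1}" for n x
    using that by (cases "x = 1") auto
  with C show ?thesis by (intro that[of C]) auto
qed

section \<open>Propagation of smoothness and of the norm in time\<close>

context gevrey_strip_wave begin

lemma growth_rate_nonneg: "0 \<le> growth_rate"
  unfolding growth_rate_def Let_def using \<sigma> K_nonneg by (auto intro!: add_nonneg_nonneg mult_nonneg_nonneg sum_nonneg)

lemma dn_eq_D:
  assumes "0 \<le> t" "smooth01 u" "\<And>x. x \<in> {0<..1} \<Longrightarrow> u x = D 0 0 t x" "x \<in> {0<..1}"
  shows "dn u n x = D 0 n t x"
  using dn_agree[of u "\<lambda>n. D 0 n t" x n] assms D_x[OF assms(1), of _ 0] by simp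

text \<open>As \<epsilon> tends to 0 the starting point of the characteristic tends to 0 as well,
  and the rate is the same for all curves, so the estimate survives the limit.\<close>

lemma trunc_energy_0_growth:
  assumes t: "0 \<le> t1" "t1 \<le> t2"
    and u1: "smooth01 u1" "\<And>x. x \<in> {0<..1} \<Longrightarrow> u1 x = D 0 0 t1 x"
    and u2: "smooth01 u2" "\<And>x. x \<in> {0<..1} \<Longrightarrow> u2 x = D 0 0 t2 x"
  shows "trunc_energy \<sigma> N 0 (dn u2) \<le> exp (growth_rate * (t2 - t1)) * trunc_energy \<sigma> N 0 (dn u1)"
proof (rule tendsto_le)
  have t2: "0 \<le> t2" using t by simp
  show "((\<lambda>\<epsilon>. trunc_energy \<sigma> N \<epsilon> (\<lambda>n. D 0 n t2)) \<longlongrightarrow> trunc_energy \<sigma> N 0 (dn u2)) (at_right 0)"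
    by (rule trunc_energy_tendsto[OF u2(1) dn_eq_D[OF t2 u2]])
  have lim1: "((\<lambda>\<epsilon>. trunc_energy \<sigma> N \<epsilon> (\<lambda>n. D 0 n t1)) \<longlongrightarrow> trunc_energy \<sigma> N 0 (dn u1)) (at_right 0)"
    by (rule trunc_energy_tendsto[OF u1(1) dn_eq_D[OF t(1) u1]])
  have ev: "\<forall>\<^sub>F \<epsilon> in at_right 0. \<epsilon> \<in> {0<..<1::real}" by (rule eventually_at_right_real) simp
  have "filterlim (\<lambda>\<epsilon>. \<epsilon> / (1 + \<epsilon> * (t2 - t1))) (at_right 0) (at_right 0)"
    unfolding filterlim_at
  proof
    show "((\<lambda>\<epsilon>. \<epsilon> / (1 + \<epsilon> * (t2 - t1))) \<longlongrightarrow> 0) (at_right 0)"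
      by (auto intro!: tendsto_eq_intros)
    show "\<forall>\<^sub>F \<epsilon> in at_right 0. \<epsilon> / (1 + \<epsilon> * (t2 - t1)) \<in> {0<..} \<and> \<epsilon> / (1 + \<epsilon> * (t2 - t1)) \<noteq> 0"
      using ev
    proof eventually_elim
      case (elim \<epsilon>)
      then have "0 < 1 + \<epsilon> * (t2 - t1)" using t by (intro add_pos_nonneg) auto
      then show ?case using elim by auto
    qed
  qed
  from filterlim_compose[OF lim1 this]
  show "((\<lambda>\<epsilon>. exp (growth_rate * (t2 - t1)) * trunc_energy \<sigma> N (\<epsilon> / (1 + \<epsilon> * (t2 - t1))) (\<lambda>n. D 0 n t1))
      \<longlongrightarrow> exp (growth_rate * (t2 - t1)) * trunc_energy \<sigma> N 0 (dn u1)) (at_right 0)"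
    by (rule tendsto_mult_left)
  show "\<forall>\<^sub>F \<epsilon> in at_right 0. trunc_energy \<sigma> N \<epsilon> (\<lambda>n. D 0 n t2)
      \<le> exp (growth_rate * (t2 - t1)) * trunc_energy \<sigma> N (\<epsilon> / (1 + \<epsilon> * (t2 - t1))) (\<lambda>n. D 0 n t1)"
    using ev by eventually_elim (intro trunc_energy_growth t, auto)
qed simp

lemma trunc_energy_ge:
  assumes "0 \<le> t" "0 < b" "b \<le> 1" "n \<le> N"
  shows "weight \<sigma> n * \<sigma> * (cmod (D 0 (Suc n) t b))\<^sup>2 \<le> trunc_energy \<sigma> N b (\<lambda>n. D 0 n t)"
    and "integral {b..1} (\<lambda>x. (cmod (D 0 1 t x))\<^sup>2) \<le> trunc_energy \<sigma> N b (\<lambda>n. D 0 n t)"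
proof -
  let ?I = "\<lambda>k n. integral {b..1} (\<lambda>x. x ^ k * (cmod (D 0 (Suc n) t x))\<^sup>2)"
  have I0: "0 \<le> ?I k n" for k n
    using assms
    by (intro integral_nonneg integrable_continuous_real continuous_intros D_slice_continuous_on) auto
  have w0: "0 \<le> weight \<sigma> n" for n using weight_pos[OF \<sigma>(1)] by (simp add: less_imp_le)
  let ?T = "\<lambda>n. weight \<sigma> n * ((\<Sum>k\<le>2. (real n / \<sigma>) ^ k * ?I k n) + \<sigma> * (cmod (D 0 (Suc n) t b))\<^sup>2)"
  have S0: "0 \<le> (\<Sum>k\<le>2. (real n / \<sigma>) ^ k * ?I k n)" for n
    using \<sigma> I0 by (intro sum_nonneg mult_nonneg_nonneg) auto
  have T0: "0 \<le> ?T n" for n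
    using \<sigma> S0 w0 by (intro mult_nonneg_nonneg add_nonneg_nonneg) auto
  have T_le: "?T m \<le> trunc_energy \<sigma> N b (\<lambda>n. D 0 n t)" if "m \<le> N" for m
    unfolding trunc_energy_def using that T0 by (intro member_le_sum) auto
  have "weight \<sigma> n * \<sigma> * (cmod (D 0 (Suc n) t b))\<^sup>2 \<le> ?T n"
    using mult_nonneg_nonneg[OF w0 S0, of n n] by (simp add: distrib_left)
  with T_le[OF assms(4)] show "weight \<sigma> n * \<sigma> * (cmod (D 0 (Suc n) t b))\<^sup>2 \<le> trunc_energy \<sigma> N b (\<lambda>n. D 0 n t)"
    by linarith
  have "integral {b..1} (\<lambda>x. (cmod (D 0 1 t x))\<^sup>2) \<le> ?T 0"
    using \<sigma> by (simp add: numeral_2_eq_2)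
  with T_le[of 0] show "integral {b..1} (\<lambda>x. (cmod (D 0 1 t x))\<^sup>2) \<le> trunc_energy \<sigma> N b (\<lambda>n. D 0 n t)"
    by linarith
qed

text \<open>The endpoint \<epsilon> of the curve is arbitrary, so the boundary part of the energy
  cut at order m bounds v_m at every x in (0,1]. The bound is uniform because the initial energy is
  continuous in the starting point up to 0. psi itself is bounded by
  \<open>norm_psi_le\<close>.\<close>

lemma smooth_at_later_time:
  assumes t: "0 \<le> t1" "t1 \<le> t2"
    and u1: "smooth01 u1" "\<And>x. x \<in> {0<..1} \<Longrightarrow> u1 x = D 0 0 t1 x"
  obtains u2 where "smooth01 u2" "\<And>x. x \<in> {0<..1} \<Longrightarrow> u2 x = D 0 0 t2 x"
proof -
  have t2: "0 \<le> t2" using t by simp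
  have E_bdd: "\<exists>B. \<forall>\<epsilon>\<in>{0<..1}. trunc_energy \<sigma> N \<epsilon> (\<lambda>n. D 0 n t2) \<le> B" for N
  proof -
    have "compact ((\<lambda>a. trunc_energy \<sigma> N a (dn u1)) ` {0..1})"
      by (intro compact_continuous_image trunc_energy_continuous u1 compact_Icc)
    then have "bdd_above ((\<lambda>a. trunc_energy \<sigma> N a (dn u1)) ` {0..1})"
      by (intro bounded_imp_bdd_above compact_imp_bounded)
    then obtain M where M: "\<And>a. a \<in> {0..1} \<Longrightarrow> trunc_energy \<sigma> N a (dn u1) \<le> M"
      unfolding bdd_above_def by (auto simp del: atLeastAtMost_iff)
    have "trunc_energy \<sigma> N \<epsilon> (\<lambda>n. D 0 n t2) \<le> exp (growth_rate * (t2 - t1)) * M" if "\<epsilon> \<in> {0<..1}" for \<epsilon>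
    proof -
      define a where "a = \<epsilon> / (1 + \<epsilon> * (t2 - t1))"
      have pos: "1 \<le> 1 + \<epsilon> * (t2 - t1)" using that t by simp
      have a: "a \<in> {0<..1}"
      proof -
        have "0 < a" unfolding a_def using that less_le_trans[OF zero_less_one pos] by simp
        moreover have "a \<le> 1" unfolding a_def using that pos by (simp add: divide_le_eq)
        ultimately show ?thesis by simp
      qed
      have "trunc_energy \<sigma> N \<epsilon> (\<lambda>n. D 0 n t2)
          \<le> exp (growth_rate * (t2 - t1)) * trunc_energy \<sigma> N a (\<lambda>n. D 0 n t1)"
        unfolding a_def by (rule trunc_energy_growth[OF t]) (use that in auto)
      also have "trunc_energy \<sigma> N a (\<lambda>n. D 0 n t1) = trunc_energy \<sigma> N a (dn u1)"
        by (rule trunc_energy_cong) (use a dn_eq_D[OF t(1) u1] in auto)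
      also have "exp (growth_rate * (t2 - t1)) * trunc_energy \<sigma> N a (dn u1)
          \<le> exp (growth_rate * (t2 - t1)) * M"
        using a by (intro mult_left_mono M) auto
      finally show ?thesis .
    qed
    then show ?thesis by blast
  qed
  have bdd: "\<exists>B. \<forall>x\<in>{0<..1}. cmod (D 0 n t2 x) \<le> B" for n
  proof (cases n)
    case 0
    obtain B where B: "\<And>\<epsilon>. \<epsilon> \<in> {0<..1} \<Longrightarrow> trunc_energy \<sigma> 0 \<epsilon> (\<lambda>n. D 0 n t2) \<le> B"
      using E_bdd by blast
    have "cmod (D 0 0 t2 x) \<le> sqrt B" if x: "x \<in> {0<..1}" for x
    proof -
      have "(cmod (D 0 0 t2 x))\<^sup>2 \<le> B"
        using norm_psi_le[OF t2, of x x] trunc_energy_ge(2)[OF t2, of x 0 0] B[OF x] x by fastforce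
      then show ?thesis by (rule real_le_rsqrt)
    qed
    then show ?thesis using 0 by blast
  next
    case (Suc m)
    obtain B where B: "\<And>\<epsilon>. \<epsilon> \<in> {0<..1} \<Longrightarrow> trunc_energy \<sigma> m \<epsilon> (\<lambda>n. D 0 n t2) \<le> B"
      using E_bdd by blast
    have c: "0 < weight \<sigma> m * \<sigma>" using weight_pos \<sigma> by simp
    have "cmod (D 0 n t2 x) \<le> sqrt (B / (weight \<sigma> m * \<sigma>))" if x: "x \<in> {0<..1}" for x
    proof -
      have "weight \<sigma> m * \<sigma> * (cmod (D 0 n t2 x))\<^sup>2 \<le> B"
        unfolding Suc using trunc_energy_ge(1)[OF t2, of x m m] B[OF x] x by auto
      then have "(cmod (D 0 n t2 x))\<^sup>2 \<le> B / (weight \<sigma> m * \<sigma>)"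
        using c by (simp add: pos_le_divide_eq mult.commute)
      then show ?thesis by (rule real_le_rsqrt)
    qed
    then show ?thesis by blast
  qed
  obtain u2 where "smooth01 u2" "\<And>n x. x \<in> {0<..1} \<Longrightarrow> dn u2 n x = D 0 n t2 x"
    using smooth_extension_at_0[of "\<lambda>n. D 0 n t2", OF D_x[OF t2] bdd] by blast
  then show ?thesis using that[of u2] dn.simps(1) by metis
qed

lemma trunc_energy_0_le_Xnorm:
  assumes t: "0 \<le> t1" "t1 \<le> t2"
    and u1: "u1 \<in> Xsig \<sigma>" "\<And>x. x \<in> {0<..1} \<Longrightarrow> u1 x = D 0 0 t1 x"
    and u2: "smooth01 u2" "\<And>x. x \<in> {0<..1} \<Longrightarrow> u2 x = D 0 0 t2 x"
  shows "trunc_energy \<sigma> N 0 (dn u2) \<le> exp (growth_rate * (t2 - t1)) * (Xnorm \<sigma> u1)\<^sup>2"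
proof -
  have "smooth01 u1" using u1(1) by (simp add: Xsig_def)
  then have "trunc_energy \<sigma> N 0 (dn u2) \<le> exp (growth_rate * (t2 - t1)) * trunc_energy \<sigma> N 0 (dn u1)"
    using u1(2) u2 by (intro trunc_energy_0_growth[OF t])
  also have "\<dots> \<le> exp (growth_rate * (t2 - t1)) * (Xnorm \<sigma> u1)\<^sup>2"
    by (intro mult_left_mono trunc_energy_LIMSEQ(2)[OF \<sigma>(1) u1(1)]) simp
  finally show ?thesis .
qed

text \<open>The truncated energies converge to the squared norm; taking roots halves the
  rate.\<close>

lemma Xnorm_growth:
  assumes t: "0 \<le> t1" "t1 \<le> t2"
    and u1: "u1 \<in> Xsig \<sigma>" "\<And>x. x \<in> {0<..1} \<Longrightarrow> u1 x = D 0 0 t1 x"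
    and u2: "u2 \<in> Xsig \<sigma>" "\<And>x. x \<in> {0<..1} \<Longrightarrow> u2 x = D 0 0 t2 x"
  shows "Xnorm \<sigma> u2 \<le> exp (growth_rate / 2 * (t2 - t1)) * Xnorm \<sigma> u1"
proof (rule power2_le_imp_le)
  have "(Xnorm \<sigma> u2)\<^sup>2 \<le> exp (growth_rate * (t2 - t1)) * (Xnorm \<sigma> u1)\<^sup>2"
  proof (rule LIMSEQ_le_const2[OF trunc_energy_LIMSEQ(1)[OF \<sigma>(1) u2(1)]])
    have "smooth01 u2" using u2(1) by (simp add: Xsig_def)
    from trunc_energy_0_le_Xnorm[OF t u1 this u2(2)]
    show "\<exists>M. \<forall>N\<ge>M. trunc_energy \<sigma> N 0 (dn u2) \<le> exp (growth_rate * (t2 - t1)) * (Xnorm \<sigma> u1)\<^sup>2"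
      by blast
  qed
  also have "\<dots> = (exp (growth_rate / 2 * (t2 - t1)) * Xnorm \<sigma> u1)\<^sup>2"
    by (simp add: power_mult_distrib exp_double[symmetric])
  finally show "(Xnorm \<sigma> u2)\<^sup>2 \<le> (exp (growth_rate / 2 * (t2 - t1)) * Xnorm \<sigma> u1)\<^sup>2" .
  show "0 \<le> exp (growth_rate / 2 * (t2 - t1)) * Xnorm \<sigma> u1"
    using Xnorm_nonneg[OF \<sigma>(1) u1(1)] by simp
qed

lemma Xsig_at_later_time:
  assumes t: "0 \<le> t1" "t1 \<le> t2"
    and u1: "u1 \<in> Xsig \<sigma>" "\<And>x. x \<in> {0<..1} \<Longrightarrow> u1 x = D 0 0 t1 x"
  obtains u2 where "u2 \<in> Xsig \<sigma>" "\<And>x. x \<in> {0<..1} \<Longrightarrow> u2 x = D 0 0 t2 x"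
proof -
  have sm: "smooth01 u1" using u1 by (simp add: Xsig_def)
  obtain u2 where u2: "smooth01 u2" "\<And>x. x \<in> {0<..1} \<Longrightarrow> u2 x = D 0 0 t2 x"
    using smooth_at_later_time[OF t sm u1(2)] by blast
  have "u2 \<in> Xsig \<sigma>"
  proof (rule XsigI[OF \<sigma>(1) u2(1)])
    show "u2 1 = 0" using u2(2)[of 1] dirichlet t by simp
    show "trunc_energy \<sigma> N 0 (dn u2) \<le> exp (growth_rate * (t2 - t1)) * (Xnorm \<sigma> u1)\<^sup>2" for N
      by (rule trunc_energy_0_le_Xnorm[OF t u1 u2])
  qed
  with u2(2) that show ?thesis by blast
qed

end

theorem mainTheorem7:
  fixes W :: "real \<Rightarrow> complex" and \<sigma> \<sigma>s :: real
  assumes "gevrey_regular \<sigma>s 2 W" and "0 < \<sigma>" and "\<sigma> < \<sigma>s"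
  shows "\<exists>c\<ge>0. \<forall>\<psi> :: real \<Rightarrow> real \<Rightarrow> complex.
           strip_solution W \<psi> \<and> (\<forall>t\<ge>0. \<psi> t 1 = 0) \<and> inX \<sigma> (\<psi> 0) \<longrightarrow>
             (\<forall>t\<ge>0. inX \<sigma> (\<psi> t)) \<and>
             (\<forall>t1 t2. 0 \<le> t1 \<and> t1 \<le> t2 \<longrightarrow>
                (\<lambda>t. normX \<sigma> (\<psi> t)) integrable_on {t1..t2} \<and>
                normX \<sigma> (\<psi> t2) - normX \<sigma> (\<psi> t1)
                  \<le> c * integral {t1..t2} (\<lambda>t. normX \<sigma> (\<psi> t)))"
proof -
  obtain C where C: "0 \<le> C" "\<And>n x. x \<in> {0<..1} \<Longrightarrow> cmod (dn W n x) \<le> C * ((fact n)\<^sup>2 / \<sigma>s ^ n)"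
    using gevrey_regular_bound[OF assms(1)] by blast
  \<comment> \<open>\<open>c\<close> is fixed before psi, as the rate depends only on \<sigma>,
    \<sigma>s and C. The \<open>max\<close> gives 0 <= c before the locale is interpreted;
    afterwards \<open>growth_rate_nonneg\<close> identifies c with half the rate.\<close>
  define c where "c = max 0 (gevrey_strip_wave.growth_rate \<sigma> \<sigma>s C / 2)"
  show ?thesis
  proof (intro exI[of _ c] conjI allI impI)
    show "0 \<le> c" by (simp add: c_def)
    fix \<psi> :: "real \<Rightarrow> real \<Rightarrow> complex"
    assume *: "strip_solution W \<psi> \<and> (\<forall>t\<ge>0. \<psi> t 1 = 0) \<and> inX \<sigma> (\<psi> 0)"
    then obtain D where D: "\<forall>p\<in>strip. D 0 0 (fst p) (snd p) = \<psi> (fst p) (snd p)"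
      "\<forall>i j. \<forall>p\<in>strip.
          ((\<lambda>q. D i j (fst q) (snd q)) has_derivative
            (\<lambda>h. fst h *\<^sub>R D (Suc i) j (fst p) (snd p) + snd h *\<^sub>R D i (Suc j) (fst p) (snd p)))
          (at p within strip)"
      "\<forall>p\<in>strip.
          complex_of_real ((snd p)\<^sup>2) * D 0 2 (fst p) (snd p)
          + complex_of_real (2 * snd p) * D 0 1 (fst p) (snd p)
          + D 1 1 (fst p) (snd p) - W (snd p) * D 0 0 (fst p) (snd p) = 0"
      unfolding strip_solution_def by blast
    have D0: "D 0 0 t x = \<psi> t x" if "0 \<le> t" "x \<in> {0<..1}" for t x
      using D(1) that by (auto simp: strip_def)
    interpret gevrey_strip_wave W D \<sigma> \<sigma>s C
    proof
      show "smooth01 W" using assms(1) by (simp add: gevrey_regular_def)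
      show "D 0 0 t 1 = 0" if "0 \<le> t" for t using D0[OF that] * that by simp
    qed (use D(2,3) assms C in auto)
    have c_eq: "c = growth_rate / 2" using growth_rate_nonneg by (simp add: c_def)
    obtain u0 where u0: "u0 \<in> Xsig \<sigma>" "\<And>x. x \<in> {0<..1} \<Longrightarrow> u0 x = D 0 0 0 x"
      using * D0 unfolding inX_def by auto
    \<comment> \<open>The same choice as in \<open>normX\<close>, so that the norm of psi(t) is that
      of \<open>u t\<close> by definition.\<close>
    define u where "u t = (SOME u. u \<in> Xsig \<sigma> \<and> (\<forall>x\<in>{0<..1}. u x = \<psi> t x))" for t
    have inX: "\<exists>v. v \<in> Xsig \<sigma> \<and> (\<forall>x\<in>{0<..1}. v x = \<psi> t x)" if "0 \<le> t" for t
      using Xsig_at_later_time[OF order_refl that u0] D0[OF that] by metis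
    then show "inX \<sigma> (\<psi> t)" if "0 \<le> t" for t unfolding inX_def using that by blast
    have u: "u t \<in> Xsig \<sigma>" "\<And>x. x \<in> {0<..1} \<Longrightarrow> u t x = D 0 0 t x" if "0 \<le> t" for t
      using someI_ex[OF inX[OF that]] D0[OF that] unfolding u_def[symmetric] by auto
    have norm_eq: "normX \<sigma> (\<psi> t) = Xnorm \<sigma> (u t)" for t by (simp add: normX_def u_def)
    have growth: "normX \<sigma> (\<psi> t) \<le> exp (c * (t - s)) * normX \<sigma> (\<psi> s)" if "0 \<le> s" "s \<le> t" for s t
      unfolding norm_eq c_eq using that by (intro Xnorm_growth u) auto
    have nonneg: "0 \<le> normX \<sigma> (\<psi> t)" if "0 \<le> t" for t
      unfolding norm_eq by (rule Xnorm_nonneg[OF \<sigma>(1) u(1)[OF that]])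
    fix t1 t2 :: real assume "0 \<le> t1 \<and> t1 \<le> t2"
    then have "(\<lambda>t. normX \<sigma> (\<psi> t)) integrable_on {t1..t2} \<and>
        normX \<sigma> (\<psi> t2) - normX \<sigma> (\<psi> t1) \<le> c * integral {t1..t2} (\<lambda>t. normX \<sigma> (\<psi> t))"
      by (intro exponential_growth_integral nonneg growth) (auto simp: c_def)
    then show "(\<lambda>t. normX \<sigma> (\<psi> t)) integrable_on {t1..t2}"
      "normX \<sigma> (\<psi> t2) - normX \<sigma> (\<psi> t1) \<le> c * integral {t1..t2} (\<lambda>t. normX \<sigma> (\<psi> t))" by blast+
  qed
qed

end
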